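(* Let $q$ be a prime power, $n\ge 2$ an integer, $d$ an even integer with $2\le d\le n$, and let $X(n,q)$ be the set of $n\times n$ Hermitian matrices over $\mathbb{F}_{q^2}$. Every $d$-code $Y$ in $X(n,q)$ satisfies \[ |Y|\le (-1)^{n+1}q^{n(n-d+1)}\frac{((-q)^{n-d+2}-1)+(-q)^n((-q)^{n-d+1}-1)}{(-q)^{n-d+2}-(-q)^{n-d+1}}. \]
   Context: For $x\in\mathbb{F}_{q^2}$ write $\overline{x}=x^q$; for a matrix $A$ over $\mathbb{F}_{q^2}$, $A^*$ denotes the conjugate transpose. A square matrix $A$ is Hermitian if $A^*=A$. A nonempty subset $Y\subseteq X(n,q)$ is a $d$-code if $\operatorname{rank}(A-B)\ge d$ for all distinct $A,B\in Y$. *)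

theory Defs
  imports "Jordan_Normal_Form.DL_Rank" "HOL-Computational_Algebra.Primes"
begin

definition conjq :: "nat \<Rightarrow> 'a::field \<Rightarrow> 'a" where
  "conjq q x = x ^ q"

text \<open>X(n,q): n x n Hermitian matrices (A^* = A) over the field 'a = F_{q^2}.\<close>
definition hermitian_mats :: "nat \<Rightarrow> nat \<Rightarrow> 'a::field mat set" where
  "hermitian_mats n q = {A \<in> carrier_mat n n.
      \<forall>i<n. \<forall>j<n. A $$ (i, j) = conjq q (A $$ (j, i))}"

definition mrank :: "nat \<Rightarrow> 'a::field mat \<Rightarrow> nat" where
  "mrank n A = vec_space.rank n A"

definition is_d_code :: "nat \<Rightarrow> nat \<Rightarrow> nat \<Rightarrow> 'a::field mat set \<Rightarrow> bool" where
  "is_d_code n q d Y \<longleftrightarrow> Y \<noteq> {} \<and> Y \<subseteq> hermitian_mats n q \<and>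
     (\<forall>A\<in>Y. \<forall>B\<in>Y. A \<noteq> B \<longrightarrow> mrank n (A - B) \<ge> d)"

end

theory Submission
  imports Defs Complex_Main
begin

text \<open>
  Put \<open>b = - q\<close> and let \<open>\<psi>\<close> be an additive character of the field, nontrivial on the subfield of order
  \<open>q\<close>. The Gauss sum \<open>g(C)\<close> of a Hermitian matrix \<open>C\<close>, the sum of \<open>\<psi> (x\<^sup>* C x)\<close> over all vectors \<open>x\<close>,
  equals \<open>b\<close> to the power \<open>2 n - rank C\<close>. Its \<open>t\<close>-th power is a sum of characters indexed by Gram
  matrices of \<open>t\<close>-tuples of vectors, which have rank at most \<open>t\<close>; so the Fourier transform of a
  polynomial of degree less than \<open>d\<close> in \<open>g(C)\<close> vanishes on matrices of rank at least \<open>d\<close>. Delsarte's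
  linear programming argument then bounds \<open>|Y|\<close> by the sum over all \<open>C\<close> of \<open>f(C)\<close> divided by \<open>f(0)\<close>,
  for every nonnegative such polynomial \<open>f\<close>. With \<open>z = g(C) / b\<^sup>n\<close>, the choice is
  \<open>f = (- 1)\<^sup>n (z - 1) (z - b) \<dots> (z - b\<^bsup>d - 3\<^esup>) (z - b\<^bsup>n - 1\<^esup>)\<close>. The sum of \<open>f\<close> over all Hermitian
  matrices follows by induction on \<open>n\<close>, bordering a matrix by one row and column.
\<close>

subsection \<open>Finite fields and additive characters\<close>

text \<open>Multiplication by a nonzero \<open>x\<close> permutes the nonzero elements, so the
  product of all of them does not change.\<close>

lemma finite_field_power_card:
  fixes x :: "'a::{finite,field}"
  shows "x ^ card (UNIV :: 'a set) = x"
proof (cases "x = 0")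
  case True
  then show ?thesis by (simp add: power_0_left)
next
  case False
  let ?U = "UNIV - {0 :: 'a}"
  have "(\<Prod>y\<in>?U. y) = (\<Prod>y\<in>?U. x * y)"
    by (rule prod.reindex_bij_witness[of _ "\<lambda>y. x * y" "\<lambda>y. y / x"]) (use False in auto)
  also have "\<dots> = x ^ card ?U * (\<Prod>y\<in>?U. y)"
    by (simp add: prod.distrib)
  finally have "x ^ card ?U = 1" by simp
  moreover have "card (UNIV :: 'a set) = Suc (card ?U)"
    using card.remove[of UNIV "0 :: 'a"] by simp
  ultimately show ?thesis by (metis mult.right_neutral power_Suc)
qed

text \<open>Translation by 1 permutes the field, so the sum of all elements gains the field size and
  yet stays the same.\<close>

lemma CHAR_dvd_card_UNIV: "CHAR('a::{finite,field}) dvd card (UNIV :: 'a set)"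
proof -
  have "(\<Sum>x\<in>UNIV. x :: 'a) = (\<Sum>x\<in>UNIV. x + 1)"
    by (rule sum.reindex_bij_witness[of _ "\<lambda>x. x + 1" "\<lambda>x. x - 1"]) auto
  then have "of_nat (card (UNIV :: 'a set)) = (0 :: 'a)"
    by (simp add: sum.distrib)
  then show ?thesis by (simp add: of_nat_eq_0_iff_char_dvd)
qed

text \<open>An additive subgroup that is maximal among those avoiding 1 is a complement of the prime field.\<close>

lemma exists_additive_character:
  "\<exists>\<psi> :: 'a::{finite,field} \<Rightarrow> complex.
     (\<forall>x y. \<psi> (x + y) = \<psi> x * \<psi> y) \<and> (\<forall>x. norm (\<psi> x) = 1) \<and> \<psi> 1 \<noteq> 1"
proof -
  define p where "p = CHAR('a)"
  have "p > 0" using finite_imp_CHAR_pos[where ?'a='a] by (simp add: p_def)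
  then have p: "prime p" using prime_CHAR_semidom[where ?'a='a] by (simp add: p_def)
  \<comment> \<open>Only closure under addition is required; in characteristic \<open>p\<close> a
    negative is the multiple by \<open>p - 1\<close>.\<close>
  define P where "P H \<longleftrightarrow> (0::'a) \<in> H \<and> (\<forall>x\<in>H. \<forall>y\<in>H. x + y \<in> H) \<and> 1 \<notin> H" for H
  have "P {0}" by (simp add: P_def)
  then obtain H where H: "P H" and max: "\<And>H'. P H' \<Longrightarrow> H \<subseteq> H' \<Longrightarrow> H = H'"
    using finite_has_maximal[of "{H. P H}"] by auto
  have add: "x + y \<in> H" if "x \<in> H" "y \<in> H" for x y using H that by (auto simp: P_def)
  have nmult: "of_nat k * x \<in> H" if "x \<in> H" for k x
    by (induction k) (use that H in \<open>auto simp: algebra_simps P_def\<close>)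
  have neg: "- x \<in> H" if "x \<in> H" for x
  proof -
    have "of_nat (p - 1) * x = - x"
      using \<open>p > 0\<close> by (simp add: of_nat_diff p_def algebra_simps)
    then show ?thesis using nmult[OF that, of "p - 1"] by simp
  qed
  have imult: "of_int m * x \<in> H" if "x \<in> H" for m x
    using nmult[OF that, of "nat m"] neg[OF nmult[OF that, of "nat (- m)"]]
    by (cases "m \<ge> 0") (auto simp: of_nat_nat)
  have of_int_eq0: "of_int m = (0::'a) \<longleftrightarrow> int p dvd m" for m
    by (simp add: of_int_eq_0_iff_char_dvd p_def)
  have inv: "\<exists>l. of_int l * of_int m = (1 :: 'a)" if "\<not> int p dvd m" for m
  proof -
    have "coprime m (int p)" using p that
      by (metis coprime_commute prime_imp_coprime prime_nat_int_transfer)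
    then obtain u v where "u * m + v * int p = 1"
      using bezout_int[of m "int p"] by (metis coprime_imp_gcd_eq_1)
    then have "of_int (u * m + v * int p) = (1 :: 'a)" by simp
    then show ?thesis by (auto simp: p_def)
  qed
  have inH: "int p dvd m" if "of_int m \<in> H" for m
    using inv[of m] imult[OF that] H unfolding P_def by metis
  have ex: "\<exists>m. x - of_int m \<in> H" for x
  proof (cases "x \<in> H")
    case True
    then show ?thesis by (intro exI[of _ 0]) simp
  next
    case False
    \<comment> \<open>Adjoining \<open>x\<close> to \<open>H\<close> gives a strictly larger
      additive set, which by maximality must contain 1; solving \<open>h + k x = 1\<close> modulo
      \<open>H\<close> then makes \<open>x\<close> congruent to an integer.\<close>
    let ?H' = "{h + of_nat k * x | h k. h \<in> H}"
    have sub: "H \<subseteq> ?H'"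
    proof
      fix h assume "h \<in> H"
      then show "h \<in> ?H'" by (intro CollectI exI[of _ h] exI[of _ "0::nat"]) simp
    qed
    have "x \<in> ?H'" using H by (intro CollectI exI[of _ "0::'a"] exI[of _ "1::nat"]) (simp add: P_def)
    with False sub have "\<not> P ?H'" using max[of ?H'] by auto
    moreover have "y + z \<in> ?H'" if "y \<in> ?H'" "z \<in> ?H'" for y z
    proof -
      from that obtain h k h' k' where "h \<in> H" "h' \<in> H"
        "y = h + of_nat k * x" "z = h' + of_nat k' * x" by auto
      then show ?thesis using add[of h h']
        by (intro CollectI exI[of _ "h + h'"] exI[of _ "k + k'"]) (auto simp: algebra_simps)
    qed
    moreover have "0 \<in> ?H'" using sub H unfolding P_def by blast
    ultimately have "1 \<in> ?H'" unfolding P_def by blast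
    then obtain h k where hk: "h \<in> H" "h + of_nat k * x = 1" by force
    have "\<not> int p dvd int k"
    proof
      assume "int p dvd int k"
      then have "of_nat k = (0::'a)" using of_int_eq0[of "int k"] by simp
      with hk(2) have "h = 1" by simp
      then show False using hk(1) H unfolding P_def by blast
    qed
    then obtain l where l: "of_int l * of_int (int k) = (1::'a)" using inv by blast
    have "x = of_int l * (of_nat k * x)" using l by (simp flip: mult.assoc)
    also have "of_nat k * x = 1 - h" using hk(2) by (simp add: eq_diff_eq add.commute)
    finally have "x - of_int l = - (of_int l * h)" by (simp add: right_diff_distrib)
    then show ?thesis using neg[OF imult[OF hk(1), of l]] by metis
  qed
  \<comment> \<open>The integer \<open>lam x\<close> is determined only modulo \<open>p\<close>; the
    exponential \<open>e\<close> has period \<open>p\<close>, so the choice does not matter.\<close>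
  define lam where "lam x = (SOME m. x - of_int m \<in> H)" for x
  have lam: "x - of_int (lam x) \<in> H" for x
    unfolding lam_def using ex[of x] by (rule someI_ex)
  define e where "e m = cis (2 * pi * of_int m / of_nat p)" for m :: int
  have e_add: "e (m + l) = e m * e l" for m l
    by (simp add: e_def cis_mult add_divide_distrib distrib_left)
  have e_p: "e (int p * m) = 1" for m
    using \<open>p > 0\<close> cis_multiple_2pi[of "of_int m"] by (simp add: e_def mult.assoc)
  have e_cong: "e m = e l" if "int p dvd m - l" for m l
  proof -
    from that obtain j where "m = int p * j + l" by (auto simp: dvd_def algebra_simps)
    then show ?thesis by (simp add: e_add e_p)
  qed
  have "e (lam (x + y)) = e (lam x) * e (lam y)" for x y
  proof -
    have "((x - of_int (lam x)) + (y - of_int (lam y))) + - (x + y - of_int (lam (x + y))) \<in> H"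
      by (intro add neg lam)
    then have "of_int (lam (x + y) - (lam x + lam y)) \<in> H" by (simp add: algebra_simps)
    then have "e (lam (x + y)) = e (lam x + lam y)" by (intro e_cong inH)
    then show ?thesis by (simp add: e_add)
  qed
  moreover have "e (lam 1) \<noteq> 1"
  proof -
    have "of_int (1 - lam 1) \<in> H" using lam[of 1] by simp
    then have "e (lam 1) = e 1" using e_cong[OF inH] by metis
    moreover have "e 1 \<noteq> 1"
    proof
      assume "e 1 = 1"
      then have "cos (2 * pi / p) = 1" by (auto simp: e_def complex_eq_iff)
      then obtain m :: int where "2 * pi / p = of_int m * 2 * pi"
        using cos_one_2pi_int by blast
      then have "1 = real_of_int (m * int p)" using \<open>p > 0\<close> by (simp add: field_simps)
      then have "m * int p = 1" by linarith
      then have "int p dvd 1" by (metis dvd_triv_right)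
      then show False using p by (auto simp: prime_nat_iff)
    qed
    ultimately show ?thesis by simp
  qed
  ultimately show ?thesis
    by (intro exI[of _ "\<lambda>x. e (lam x)"]) (auto simp: e_def)
qed

text \<open>The permutation multiplies the sum by \<open>w\<close>, which differs from 1. The
  orthogonality relations below come from such shifts.\<close>

lemma sum_eq_0_by_shift:
  fixes f :: "'b \<Rightarrow> complex"
  assumes "bij_betw T S S" and "\<And>x. x \<in> S \<Longrightarrow> f (T x) = w * f x" and "w \<noteq> 1"
  shows "sum f S = 0"
proof -
  have "sum f S = (\<Sum>x\<in>S. f (T x))"
    using sum.reindex_bij_betw[OF assms(1), of f] by simp
  also have "\<dots> = w * sum f S"
    using assms(2) by (simp add: sum_distrib_left)
  finally have "(1 - w) * sum f S = 0" by (simp add: algebra_simps)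
  then show ?thesis using assms(3) by simp
qed

lemma card_power_eq_le:
  fixes c :: "'a::field"
  assumes "m > 0"
  shows "card {x. x ^ m = c} \<le> m"
proof -
  define p where "p = Polynomial.monom 1 m + [:- c:]"
  have deg: "degree p = m"
    unfolding p_def using assms by (subst degree_add_eq_left) (auto simp: degree_monom_eq)
  then have "p \<noteq> 0" using assms by auto
  then have "card {x. poly p x = 0} \<le> m" using card_poly_roots_bound deg by blast
  moreover have "{x. poly p x = 0} = {x. x ^ m = c}"
    by (auto simp: p_def poly_monom)
  ultimately show ?thesis by simp
qed

text \<open>That \<open>q\<close> is a power of the characteristic makes the \<open>q\<close>-th
  power map additive, and the field size makes it an involution. Nontriviality is asked at 1 because
  each shift below is normalised to change the argument of \<open>\<psi>\<close> by exactly
  1.\<close>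

locale hermitian_forms =
  fixes q :: nat and \<psi> :: "'a::{finite,field} \<Rightarrow> complex"
  assumes q_char_power: "\<exists>k. q = CHAR('a) ^ k"
    and card_field: "card (UNIV :: 'a set) = q ^ 2"
    and psi_add: "\<psi> (x + y) = \<psi> x * \<psi> y"
    and norm_psi [simp]: "norm (\<psi> x) = 1"
    and psi_1: "\<psi> 1 \<noteq> 1"
begin

section \<open>Conjugation, norm and trace over the subfield of order \<open>q\<close>\<close>

abbreviation cj :: "'a \<Rightarrow> 'a" where "cj \<equiv> conjq q"

lemma q_gt_1: "q > 1"
proof -
  have "card {0, 1 :: 'a} \<le> card (UNIV :: 'a set)" by (rule card_mono) auto
  then have "q ^ 2 \<ge> 2" by (simp add: card_field)
  then show ?thesis by (cases "q = 0 \<or> q = 1") auto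
qed

lemma cj_add [simp]: "cj (x + y) = cj x + cj y"
  unfolding conjq_def using q_char_power freshmans_dream'
    prime_CHAR_semidom finite_imp_CHAR_pos[where ?'a='a] by (metis finite)

lemma cj_mult [simp]: "cj (x * y) = cj x * cj y"
  by (simp add: conjq_def power_mult_distrib)

lemma cj_0 [simp]: "cj 0 = 0"
  using q_gt_1 by (simp add: conjq_def power_0_left)

lemma cj_1 [simp]: "cj 1 = 1"
  by (simp add: conjq_def)

lemma cj_minus [simp]: "cj (- x) = - cj x"
  using cj_add[of x "- x"] by (simp add: eq_neg_iff_add_eq_0 add.commute del: cj_add)

lemma cj_diff [simp]: "cj (x - y) = cj x - cj y"
  using cj_add[of x "- y"] by simp

lemma cj_divide [simp]: "cj (x / y) = cj x / cj y"
  by (simp add: conjq_def power_divide)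

lemma cj_cj [simp]: "cj (cj x) = x"
  using finite_field_power_card[of x]
  by (simp add: conjq_def card_field power2_eq_square power_mult)

lemma cj_eq_0_iff [simp]: "cj x = 0 \<longleftrightarrow> x = 0"
  using q_gt_1 by (simp add: conjq_def)

lemma cj_sum: "cj (sum f A) = (\<Sum>i\<in>A. cj (f i))"
  by (induction A rule: infinite_finite_induct) auto

lemma psi_0 [simp]: "\<psi> 0 = 1"
  using psi_add[of 0 0] norm_psi[of 0] by (metis add.right_neutral mult_cancel_left2 norm_zero zero_neq_one)

lemma psi_minus: "\<psi> (- x) = cnj (\<psi> x)"
proof -
  have "\<psi> (- x) * \<psi> x = 1" using psi_add[of "- x" x] by simp
  moreover have "cnj (\<psi> x) * \<psi> x = 1"
    using complex_norm_square[of "\<psi> x"] by (simp add: mult.commute)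
  ultimately show ?thesis
    by (metis mult_right_cancel mult_zero_right zero_neq_one)
qed

lemma psi_sum: "\<psi> (sum f A) = (\<Prod>i\<in>A. \<psi> (f i))"
  by (induction A rule: infinite_finite_induct) (auto simp: psi_add)

text \<open>The subfield of order \<open>q\<close>, in which norms, traces and Hermitian forms take
  their values.\<close>

definition K :: "'a set" where "K = {x. cj x = x}"

lemma norm_in_K: "y * cj y \<in> K"
  by (simp add: K_def mult.commute)

text \<open>The nonzero elements of \<open>K\<close> are among the \<open>q - 1\<close> possible
  roots of \<open>x^(q-1) = 1\<close>, and a norm fibre has at most \<open>q + 1\<close> elements.
  The fibres partition \<open>q^2 - 1 = (q - 1)(q + 1)\<close> nonzero elements, so both bounds are
  attained.\<close>

lemma card_K: "card K = q"
  and card_norm_fibre: "c \<in> K - {0} \<Longrightarrow> card {y. y * cj y = c} = q + 1"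
proof -
  let ?U = "UNIV - {0 :: 'a}" and ?K = "K - {0}"
  let ?fib = "\<lambda>c. {y \<in> ?U. y * cj y = c}"
  have fib: "?fib c = {y. y * cj y = c}" if "c \<in> ?K" for c using that by auto
  have fib_le: "card (?fib c) \<le> q + 1" if "c \<in> ?K" for c
    using card_power_eq_le[of "q + 1" c] unfolding fib[OF that] by (simp add: conjq_def)
  have "?K \<subseteq> {x. x ^ (q - 1) = 1}"
    using q_gt_1 by (auto simp: K_def conjq_def power_eq_if[of _ q])
  then have "card ?K \<le> card {x :: 'a. x ^ (q - 1) = 1}" by (rule card_mono[rotated]) simp
  also have "\<dots> \<le> q - 1" using q_gt_1 by (intro card_power_eq_le) simp
  finally have K_le: "card ?K \<le> q - 1" .
  have "(\<lambda>y. y * cj y) ` ?U \<subseteq> ?K" by (auto simp: norm_in_K)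
  then have "(\<Sum>c\<in>?K. card (?fib c)) = card ?U"
    using sum.group[of ?U ?K "\<lambda>y. y * cj y" "\<lambda>_. 1 :: nat"]
    by simp
  also have "\<dots> = q ^ 2 - 1" by (simp add: card_Diff_singleton card_field)
  also have "\<dots> = (q - 1) * (q + 1)"
    using q_gt_1 by (simp add: power2_eq_square algebra_simps)
  finally have total: "(\<Sum>c\<in>?K. card (?fib c)) = (q - 1) * (q + 1)" .
  have "(q - 1) * (q + 1) \<le> card ?K * (q + 1)"
    unfolding total[symmetric] using sum_bounded_above[of ?K "\<lambda>c. card (?fib c)" "q + 1"] fib_le
    by simp
  then have K_eq: "card ?K = q - 1" using K_le by (metis Suc_eq_plus1 le_antisym mult_le_cancel2 zero_less_Suc)
  then show "card K = q" using q_gt_1 card.remove[of K 0] by (auto simp: K_def)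
  show "card {y. y * cj y = c} = q + 1" if "c \<in> K - {0}"
  proof (rule ccontr)
    assume "card {y. y * cj y = c} \<noteq> q + 1"
    then have "card (?fib c) < q + 1" using fib_le[OF that] fib[OF that] by simp
    then have "(\<Sum>c\<in>?K. card (?fib c)) < (\<Sum>c\<in>?K. q + 1)"
      using that fib_le by (intro sum_strict_mono_ex1) auto
    then show False using total K_eq by simp
  qed
qed

lemma sum_psi_K:
  assumes "a \<in> K" "a \<noteq> 0"
  shows "(\<Sum>c\<in>K. \<psi> (a * c)) = 0"
proof (rule sum_eq_0_by_shift[where T = "\<lambda>c. c + 1 / a" and w = "\<psi> 1"])
  have "1 / a \<in> K" using assms by (simp add: K_def)
  then show "bij_betw (\<lambda>c. c + 1 / a) K K"
    by (intro bij_betw_byWitness[where f' = "\<lambda>c. c - 1 / a"]) (auto simp: K_def)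
  show "\<psi> (a * (c + 1 / a)) = \<psi> 1 * \<psi> (a * c)" for c
    using assms by (simp add: distrib_left psi_add)
qed (rule psi_1)

text \<open>For nonzero \<open>a\<close>, the point 0 contributes 1 and each nonzero
  \<open>c\<close> in \<open>K\<close> is a norm \<open>q + 1\<close> times, which gives
  \<open>1 - (q + 1) = - q\<close>.\<close>

lemma sum_psi_norm:
  assumes "a \<in> K"
  shows "(\<Sum>y\<in>UNIV. \<psi> (a * (y * cj y))) = (if a = 0 then of_nat q ^ 2 else - of_nat q)"
proof (cases "a = 0")
  case True
  then show ?thesis by (simp add: card_field)
next
  case False
  let ?U = "UNIV - {0 :: 'a}" and ?K = "K - {0}"
  have "(\<Sum>y\<in>?U. \<psi> (a * (y * cj y)))
      = (\<Sum>c\<in>?K. \<Sum>y\<in>{y \<in> ?U. y * cj y = c}. \<psi> (a * (y * cj y)))"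
    by (rule sum.group[symmetric]) (auto simp: norm_in_K)
  also have "\<dots> = (\<Sum>c\<in>?K. \<Sum>y\<in>{y. y * cj y = c}. \<psi> (a * c))"
    by (intro sum.cong) auto
  also have "\<dots> = (of_nat q + 1) * (\<Sum>c\<in>?K. \<psi> (a * c))"
    using card_norm_fibre by (simp add: sum_distrib_left add.commute)
  also have "(\<Sum>c\<in>?K. \<psi> (a * c)) = - 1"
    using sum_psi_K[OF assms False] sum.remove[of K 0 "\<lambda>c. \<psi> (a * c)"]
    by (simp add: K_def add_eq_0_iff)
  finally show ?thesis
    using False sum.remove[of UNIV 0 "\<lambda>y. \<psi> (a * (y * cj y))"] by simp
qed

text \<open>The trace polynomial \<open>x^q + x\<close> has at most \<open>q\<close> roots, so some
  element has nonzero trace; that trace is fixed by conjugation, and dividing by it normalises the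
  element. There is no division by 2, so even characteristic is covered.\<close>

lemma ex_trace_eq_1:
  assumes "c \<noteq> 0"
  shows "\<exists>s. s * c + cj (s * c) = 1"
proof -
  define p where "p = Polynomial.monom 1 q + [:0, 1 :: 'a:]"
  have deg: "degree p = q"
    unfolding p_def using q_gt_1 by (subst degree_add_eq_left) (auto simp: degree_monom_eq)
  then have "p \<noteq> 0" using q_gt_1 by auto
  then have "card {x. poly p x = 0} \<le> q" using card_poly_roots_bound deg by blast
  also have "q < card (UNIV :: 'a set)" using q_gt_1 by (simp add: card_field power2_eq_square)
  finally have "{x. poly p x = 0} \<noteq> UNIV" by auto
  then obtain u where u: "u + cj u \<noteq> 0"
    by (auto simp: p_def poly_monom conjq_def add.commute)
  let ?t = "u + cj u"
  have "cj ?t = ?t" by (simp add: add.commute)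
  then have "cj (u / ?t) = cj u / ?t" by (simp only: cj_divide)
  then have "u / ?t + cj (u / ?t) = 1" using divide_self[OF u] by (simp only: add_divide_distrib)
  then show ?thesis using assms by (intro exI[of _ "u / ?t / c"]) simp
qed

end

subsection \<open>Gauss sums of Hermitian forms\<close>

definition vec_snoc :: "'b vec \<Rightarrow> 'b \<Rightarrow> 'b vec" where
  "vec_snoc x y = vec (Suc (dim_vec x)) (\<lambda>i. if i < dim_vec x then x $ i else y)"

lemma vec_snoc_carrier: "x \<in> carrier_vec n \<Longrightarrow> vec_snoc x y \<in> carrier_vec (Suc n)"
  by (simp add: vec_snoc_def)

lemma vec_snoc_index:
  assumes "x \<in> carrier_vec n"
  shows "i < n \<Longrightarrow> vec_snoc x y $ i = x $ i" and "vec_snoc x y $ n = y"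
  using assms by (auto simp: vec_snoc_def)

lemma bij_betw_vec_snoc:
  "bij_betw (\<lambda>(x, y). vec_snoc x y) (carrier_vec n \<times> UNIV) (carrier_vec (Suc n))"
proof (rule bij_betw_byWitness[where f' = "\<lambda>w. (vec n (($) w), w $ n)"])
  show "\<forall>p\<in>carrier_vec n \<times> UNIV. (vec n (($) (case p of (x, y) \<Rightarrow> vec_snoc x y)),
      (case p of (x, y) \<Rightarrow> vec_snoc x y) $ n) = p"
    by (auto simp: vec_snoc_def intro!: eq_vecI)
  show "\<forall>w\<in>carrier_vec (Suc n). (case (vec n (($) w), w $ n) of (x, y) \<Rightarrow> vec_snoc x y) = w"
    by (auto simp: vec_snoc_def less_Suc_eq intro!: eq_vecI)
qed (auto simp: vec_snoc_def)

lemma finite_carrier_vec: "finite (carrier_vec n :: 'b::{finite,zero} vec set)"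
proof (induction n)
  case 0
  have "(carrier_vec 0 :: 'b vec set) \<subseteq> {0\<^sub>v 0}" by auto
  then show ?case by (rule finite_subset) simp
next
  case (Suc n)
  then show ?case using bij_betw_finite[OF bij_betw_vec_snoc, of n] by (metis finite_SigmaI finite)
qed

lemma sum_carrier_vec_Suc:
  fixes f :: "'b::finite vec \<Rightarrow> 'c::comm_monoid_add"
  shows "(\<Sum>w\<in>carrier_vec (Suc n). f w) = (\<Sum>y\<in>UNIV. \<Sum>x\<in>carrier_vec n. f (vec_snoc x y))"
  unfolding sum.reindex_bij_betw[OF bij_betw_vec_snoc, symmetric]
  by (subst sum.swap) (simp add: sum.cartesian_product case_prod_beta)

lemma card_carrier_vec: "card (carrier_vec n :: 'b::{finite,zero} vec set) = card (UNIV :: 'b set) ^ n"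
proof (induction n)
  case 0
  have "(carrier_vec 0 :: 'b vec set) = {0\<^sub>v 0}" by auto
  then show ?case by simp
next
  case (Suc n)
  then show ?case
    using bij_betw_same_card[OF bij_betw_vec_snoc[where ?'a = 'b], of n]
    by (simp add: card_cartesian_product mult.commute)
qed

lemma bij_betw_add_vec:
  fixes w :: "'b::ab_group_add vec"
  assumes "w \<in> carrier_vec n"
  shows "bij_betw (\<lambda>x. x + w) (carrier_vec n) (carrier_vec n)"
  using assms
  by (intro bij_betw_byWitness[where f' = "\<lambda>x. x - w"]) (auto intro!: eq_vecI)

section \<open>The trace pairing and Hermitian forms\<close>

context hermitian_forms
begin

abbreviation V :: "nat \<Rightarrow> 'a vec set" where "V \<equiv> carrier_vec"
abbreviation X :: "nat \<Rightarrow> 'a mat set" where "X n \<equiv> hermitian_mats n q"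

lemma card_V: "card (V n) = q ^ (2 * n)"
  by (simp add: card_carrier_vec card_field power_mult)

lemma X_carrier: "C \<in> X n \<Longrightarrow> C \<in> carrier_mat n n"
  by (simp add: hermitian_mats_def)

lemma X_index: "C \<in> X n \<Longrightarrow> i < n \<Longrightarrow> j < n \<Longrightarrow> C $$ (i, j) = cj (C $$ (j, i))"
  unfolding hermitian_mats_def by blast

definition tr :: "'a \<Rightarrow> 'a" where "tr x = x + cj x"

lemma tr_add: "tr (x + y) = tr x + tr y"
  by (simp add: tr_def)

lemma tr_cj: "tr (cj x) = tr x"
  by (simp add: tr_def add.commute)

lemma tr_0 [simp]: "tr 0 = 0"
  by (simp add: tr_def)

definition ip :: "nat \<Rightarrow> 'a vec \<Rightarrow> 'a vec \<Rightarrow> 'a" where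
  "ip n x y = (\<Sum>i<n. cj (x $ i) * y $ i)"

definition hf :: "nat \<Rightarrow> 'a mat \<Rightarrow> 'a vec \<Rightarrow> 'a" where
  "hf n C x = ip n x (C *\<^sub>v x)"

lemma mult_mat_vec_index:
  assumes "C \<in> carrier_mat n n" "x \<in> V n" "i < n"
  shows "(C *\<^sub>v x) $ i = (\<Sum>j<n. C $$ (i, j) * x $ j)"
  using assms by (simp add: scalar_prod_def atLeast0LessThan)

lemma ip_add_left: "x \<in> V n \<Longrightarrow> y \<in> V n \<Longrightarrow> ip n (x + y) w = ip n x w + ip n y w"
  by (simp add: ip_def sum.distrib distrib_right)

lemma ip_add_right: "x \<in> V n \<Longrightarrow> y \<in> V n \<Longrightarrow> ip n w (x + y) = ip n w x + ip n w y"
  by (simp add: ip_def sum.distrib distrib_left)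

lemma ip_smult_left: "x \<in> V n \<Longrightarrow> ip n (s \<cdot>\<^sub>v x) w = cj s * ip n x w"
  by (simp add: ip_def sum_distrib_left mult.assoc)

lemma ip_smult_right: "x \<in> V n \<Longrightarrow> ip n w (s \<cdot>\<^sub>v x) = s * ip n w x"
  by (simp add: ip_def sum_distrib_left mult_ac)

lemma ip_0_right [simp]: "ip n w (0\<^sub>v n) = 0"
  by (simp add: ip_def)

lemma cj_ip: "cj (ip n x y) = ip n y x"
  by (simp add: ip_def cj_sum mult.commute)

lemma ip_mult_mat_vec:
  assumes "C \<in> carrier_mat n n" "y \<in> V n"
  shows "ip n x (C *\<^sub>v y) = (\<Sum>i<n. \<Sum>j<n. cj (x $ i) * C $$ (i, j) * y $ j)"
  unfolding ip_def using assms
  by (intro sum.cong) (auto simp: mult_mat_vec_index sum_distrib_left mult.assoc simp del: index_mult_mat_vec)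

lemma ip_hermitian:
  assumes C: "C \<in> X n" and x: "x \<in> V n" and y: "y \<in> V n"
  shows "cj (ip n x (C *\<^sub>v y)) = ip n y (C *\<^sub>v x)"
proof -
  have "cj (ip n x (C *\<^sub>v y)) = (\<Sum>i<n. \<Sum>j<n. x $ i * cj (C $$ (i, j)) * cj (y $ j))"
    by (simp add: ip_mult_mat_vec[OF X_carrier[OF C] y] cj_sum)
  also have "\<dots> = (\<Sum>i<n. \<Sum>j<n. cj (y $ j) * C $$ (j, i) * x $ i)"
    by (intro sum.cong refl) (auto simp: X_index[OF C, symmetric] mult_ac)
  also have "\<dots> = ip n y (C *\<^sub>v x)"
    by (subst sum.swap) (simp add: ip_mult_mat_vec[OF X_carrier[OF C] x])
  finally show ?thesis .
qed

lemma hf_in_K: "C \<in> X n \<Longrightarrow> x \<in> V n \<Longrightarrow> hf n C x \<in> K"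
  by (simp add: hf_def K_def ip_hermitian)

lemma hf_add:
  assumes C: "C \<in> X n" and x: "x \<in> V n" and y: "y \<in> V n"
  shows "hf n C (x + y) = hf n C x + hf n C y + tr (ip n x (C *\<^sub>v y))"
proof -
  have "C *\<^sub>v x \<in> V n" "C *\<^sub>v y \<in> V n" using X_carrier[OF C] x y by auto
  then show ?thesis
    using ip_hermitian[OF assms] X_carrier[OF C] x y
    by (simp add: hf_def tr_def ip_add_left ip_add_right mult_add_distrib_mat_vec)
qed

text \<open>Nondegeneracy of the trace pairing: a multiple of the unit vector at a nonzero
  coordinate of \<open>w\<close> suffices.\<close>

lemma ex_tr_ip_eq_1:
  assumes "w \<in> V n" "w \<noteq> 0\<^sub>v n"
  shows "\<exists>y\<in>V n. tr (ip n y w) = 1"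
proof -
  obtain i where i: "i < n" "w $ i \<noteq> 0"
    using assms by (metis carrier_vecD eq_vecI index_zero_vec(1,2))
  obtain s where s: "tr (s * w $ i) = 1" using ex_trace_eq_1[OF i(2)] by (auto simp: tr_def)
  have "ip n (vec n (\<lambda>j. if j = i then cj s else 0)) w = (\<Sum>j<n. if j = i then s * w $ i else 0)"
    unfolding ip_def by (intro sum.cong) auto
  also have "\<dots> = s * w $ i" using i by simp
  finally show ?thesis using s by (intro bexI[of _ "vec n (\<lambda>j. if j = i then cj s else 0)"]) auto
qed

lemma sum_psi_tr_ip:
  assumes w: "w \<in> V n"
  shows "(\<Sum>x\<in>V n. \<psi> (tr (ip n x w))) = (if w = 0\<^sub>v n then of_nat q ^ (2 * n) else 0)"
proof (cases "w = 0\<^sub>v n")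
  case True
  then show ?thesis by (simp add: card_V)
next
  case False
  then obtain y where y: "y \<in> V n" "tr (ip n y w) = 1" using ex_tr_ip_eq_1[OF w] by auto
  have "(\<Sum>x\<in>V n. \<psi> (tr (ip n x w))) = 0"
    by (rule sum_eq_0_by_shift[where w = "\<psi> 1", OF bij_betw_add_vec[OF y(1)]])
      (use y psi_1 in \<open>auto simp: ip_add_left tr_add psi_add\<close>)
  then show ?thesis using False by simp
qed

section \<open>The Gauss sum, the kernel and the image of a Hermitian matrix\<close>

definition gauss :: "nat \<Rightarrow> 'a mat \<Rightarrow> complex" where
  "gauss n C = (\<Sum>x\<in>V n. \<psi> (hf n C x))"

definition ker :: "nat \<Rightarrow> 'a mat \<Rightarrow> 'a vec set" where
  "ker n C = {x \<in> V n. C *\<^sub>v x = 0\<^sub>v n}"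

lemma finite_ker [simp]: "finite (ker n C)"
  unfolding ker_def by (rule finite_subset[OF _ finite_carrier_vec[of n]]) auto

lemma zero_in_ker: "C \<in> X n \<Longrightarrow> 0\<^sub>v n \<in> ker n C"
  using X_carrier[of C n] by (auto simp: ker_def intro!: eq_vecI)

lemma bij_betw_add_ker:
  assumes C: "C \<in> X n" and z: "z \<in> ker n C"
  shows "bij_betw (\<lambda>x. x + z) (ker n C) (ker n C)"
  using z X_carrier[OF C]
  by (intro bij_betw_byWitness[where f' = "\<lambda>x. x - z"])
    (auto simp: ker_def mult_add_distrib_mat_vec mult_minus_distrib_mat_vec intro!: eq_vecI)

text \<open>After the substitution \<open>x = u + y\<close> the terms \<open>hf n C y\<close> cancel
  and a linear character in \<open>y\<close> remains; summing over \<open>y\<close> leaves only the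
  \<open>u\<close> in the kernel, where the form vanishes.\<close>

lemma gauss_mult_cnj:
  assumes C: "C \<in> X n"
  shows "gauss n C * cnj (gauss n C) = of_nat (q ^ (2 * n) * card (ker n C))"
proof -
  have "gauss n C * cnj (gauss n C) = (\<Sum>y\<in>V n. gauss n C * \<psi> (- hf n C y))"
    by (simp add: gauss_def psi_minus sum_distrib_left)
  also have "\<dots> = (\<Sum>y\<in>V n. \<Sum>u\<in>V n. \<psi> (hf n C (u + y)) * \<psi> (- hf n C y))"
    using sum.reindex_bij_betw[OF bij_betw_add_vec, of _ n "\<lambda>x. \<psi> (hf n C x)"]
    by (intro sum.cong) (auto simp: gauss_def simp flip: sum_distrib_right)
  also have "\<dots> = (\<Sum>u\<in>V n. \<Sum>y\<in>V n. \<psi> (hf n C u) * \<psi> (tr (ip n y (C *\<^sub>v u))))"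
  proof (subst sum.swap, intro sum.cong refl)
    fix u y assume uy: "u \<in> V n" "y \<in> V n"
    then have "hf n C (u + y) + - hf n C y = hf n C u + tr (ip n y (C *\<^sub>v u))"
      using hf_add[OF C uy] ip_hermitian[OF C uy] tr_cj[of "ip n u (C *\<^sub>v y)"] by simp
    then show "\<psi> (hf n C (u + y)) * \<psi> (- hf n C y) = \<psi> (hf n C u) * \<psi> (tr (ip n y (C *\<^sub>v u)))"
      by (metis psi_add)
  qed
  also have "\<dots> = (\<Sum>u\<in>V n. if u \<in> ker n C then of_nat q ^ (2 * n) else 0)"
    using X_carrier[OF C]
    by (intro sum.cong) (auto simp: ker_def sum_psi_tr_ip hf_def simp flip: sum_distrib_left)
  also have "\<dots> = (\<Sum>u\<in>ker n C. of_nat q ^ (2 * n))"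
    by (subst sum.If_cases) (auto simp: finite_carrier_vec ker_def intro!: arg_cong[where f = card])
  finally show ?thesis by (simp add: mult.commute)
qed

text \<open>The orthogonal complement of the kernel, which turns out to be the image of
  \<open>C\<close>. In this form, a vector outside it directly supplies a kernel vector for the
  shift argument.\<close>

definition perp_ker :: "nat \<Rightarrow> 'a mat \<Rightarrow> 'a vec set" where
  "perp_ker n C = {v \<in> V n. \<forall>z\<in>ker n C. ip n z v = 0}"

text \<open>Kernel vectors can be rescaled, so a nonzero pairing can be given trace 1. The factor
  \<open>y\<close> will be the last coordinate in a bordered form.\<close>

lemma ex_ker_tr_ip_eq_1:
  assumes C: "C \<in> X n" and v: "v \<in> V n - perp_ker n C" and "y \<noteq> 0"
  shows "\<exists>z\<in>ker n C. tr (y * ip n z v) = 1"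
proof -
  from v obtain z where z: "z \<in> ker n C" "ip n z v \<noteq> 0" by (auto simp: perp_ker_def)
  then obtain s where "tr (s * (y * ip n z v)) = 1"
    using ex_trace_eq_1[of "y * ip n z v"] \<open>y \<noteq> 0\<close> by (auto simp: tr_def)
  moreover have "cj s \<cdot>\<^sub>v z \<in> ker n C"
    using z(1) X_carrier[OF C] by (auto simp: ker_def mult_mat_vec[of _ n n])
  moreover have "ip n (cj s \<cdot>\<^sub>v z) v = s * ip n z v"
    using z(1) by (simp add: ker_def ip_smult_left)
  ultimately show ?thesis by (intro bexI[of _ "cj s \<cdot>\<^sub>v z"]) (simp_all add: mult_ac)
qed

text \<open>Double counting of one character sum: summing over the kernel first detects
  \<open>perp_ker\<close>, while summing over all vectors first leaves only
  \<open>z = 0\<close>.\<close>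

lemma card_perp_ker:
  assumes C: "C \<in> X n"
  shows "card (perp_ker n C) * card (ker n C) = q ^ (2 * n)"
proof -
  have "(\<Sum>v\<in>V n. \<Sum>z\<in>ker n C. \<psi> (tr (ip n z v)))
      = (\<Sum>v\<in>V n. if v \<in> perp_ker n C then of_nat (card (ker n C)) else 0)"
  proof (intro sum.cong refl)
    fix v assume v: "v \<in> V n"
    show "(\<Sum>z\<in>ker n C. \<psi> (tr (ip n z v)))
        = (if v \<in> perp_ker n C then of_nat (card (ker n C)) else 0)"
    proof (cases "v \<in> perp_ker n C")
      case True
      then show ?thesis by (simp add: perp_ker_def)
    next
      case False
      then obtain z where z: "z \<in> ker n C" "tr (ip n z v) = 1"
        using ex_ker_tr_ip_eq_1[OF C, of v 1] v by auto
      have "(\<Sum>z\<in>ker n C. \<psi> (tr (ip n z v))) = 0"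
        by (rule sum_eq_0_by_shift[where w = "\<psi> 1", OF bij_betw_add_ker[OF C z(1)]])
          (use z psi_1 in \<open>auto simp: ker_def ip_add_left tr_add psi_add\<close>)
      then show ?thesis using False by simp
    qed
  qed
  also have "\<dots> = (\<Sum>v\<in>perp_ker n C. of_nat (card (ker n C)))"
    by (subst sum.If_cases) (auto simp: finite_carrier_vec perp_ker_def intro!: arg_cong[where f = card])
  finally have "(\<Sum>v\<in>V n. \<Sum>z\<in>ker n C. \<psi> (tr (ip n z v)))
    = of_nat (card (perp_ker n C) * card (ker n C))" by simp
  moreover have "(\<Sum>v\<in>V n. \<Sum>z\<in>ker n C. \<psi> (tr (ip n z v))) = of_nat (q ^ (2 * n))"
  proof -
    have "(\<Sum>v\<in>V n. \<Sum>z\<in>ker n C. \<psi> (tr (ip n z v)))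
        = (\<Sum>z\<in>ker n C. \<Sum>v\<in>V n. \<psi> (tr (ip n v z)))"
      by (subst sum.swap, intro sum.cong refl arg_cong[where f = \<psi>]) (metis tr_cj cj_ip)
    also have "\<dots> = (\<Sum>z\<in>ker n C. if z = 0\<^sub>v n then of_nat q ^ (2 * n) else 0)"
      by (intro sum.cong) (auto simp: ker_def sum_psi_tr_ip)
    also have "\<dots> = of_nat (q ^ (2 * n))" using zero_in_ker[OF C] by (simp add: sum.delta)
    finally show ?thesis .
  qed
  ultimately show ?thesis by (metis of_nat_eq_iff)
qed

text \<open>One inclusion is Hermitian symmetry. Equality follows by counting, since the fibres of
  \<open>C\<close> over its image are cosets of the kernel.\<close>

lemma image_eq_perp_ker:
  assumes C: "C \<in> X n"
  shows "(\<lambda>x. C *\<^sub>v x) ` V n = perp_ker n C"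
proof (rule card_subset_eq)
  have Cc: "C \<in> carrier_mat n n" using C by (rule X_carrier)
  show "finite (perp_ker n C)"
    unfolding perp_ker_def by (rule finite_subset[OF _ finite_carrier_vec[of n]]) auto
  show "(\<lambda>x. C *\<^sub>v x) ` V n \<subseteq> perp_ker n C"
    using Cc ip_hermitian[OF C] by (auto simp: perp_ker_def ker_def) (metis cj_eq_0_iff ip_0_right)
  have "(\<Sum>v\<in>(\<lambda>x. C *\<^sub>v x) ` V n. card {x \<in> V n. C *\<^sub>v x = v}) = card (V n)"
    using sum.group[of "V n" "(\<lambda>x. C *\<^sub>v x) ` V n" "\<lambda>x. C *\<^sub>v x" "\<lambda>_. 1 :: nat"]
    by (simp add: finite_carrier_vec)
  moreover have "card {x \<in> V n. C *\<^sub>v x = C *\<^sub>v w} = card (ker n C)" if w: "w \<in> V n" for w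
  proof (rule bij_betw_same_card[of "\<lambda>x. x - w"])
    show "bij_betw (\<lambda>x. x - w) {x \<in> V n. C *\<^sub>v x = C *\<^sub>v w} (ker n C)"
      using w Cc
      by (intro bij_betw_byWitness[where f' = "\<lambda>x. x + w"])
        (auto simp: ker_def mult_add_distrib_mat_vec mult_minus_distrib_mat_vec intro!: eq_vecI)
  qed
  then have "(\<Sum>v\<in>(\<lambda>x. C *\<^sub>v x) ` V n. card {x \<in> V n. C *\<^sub>v x = v})
      = (\<Sum>v\<in>(\<lambda>x. C *\<^sub>v x) ` V n. card (ker n C))"
    by (intro sum.cong) auto
  ultimately have "card ((\<lambda>x. C *\<^sub>v x) ` V n) * card (ker n C) = card (perp_ker n C) * card (ker n C)"
    using card_perp_ker[OF C] by (simp add: card_V)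
  moreover have "card (ker n C) \<noteq> 0" using zero_in_ker[OF C] by (auto simp: card_eq_0_iff)
  ultimately show "card ((\<lambda>x. C *\<^sub>v x) ` V n) = card (perp_ker n C)"
    by (metis mult_right_cancel)
qed

text \<open>Writing \<open>g\<close> for the Gauss sum of \<open>C\<close>, bordering \<open>C\<close> by a vector \<open>C w\<close> completes the square and
  gives \<open>q\<^sup>2 g\<close> or \<open>- q g\<close>; bordering it by any other vector gives \<open>g\<close> again.\<close>

definition border :: "nat \<Rightarrow> 'a mat \<Rightarrow> 'a vec \<Rightarrow> 'a \<Rightarrow> 'a mat" where
  "border n C v a = mat (Suc n) (Suc n) (\<lambda>(i, j).
     if i < n then if j < n then C $$ (i, j) else v $ i
     else if j < n then cj (v $ j) else a)"

lemma border_carrier: "border n C v a \<in> carrier_mat (Suc n) (Suc n)"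
  by (simp add: border_def)

lemma border_index:
  "i < n \<Longrightarrow> j < n \<Longrightarrow> border n C v a $$ (i, j) = C $$ (i, j)"
  "i < n \<Longrightarrow> border n C v a $$ (i, n) = v $ i"
  "j < n \<Longrightarrow> border n C v a $$ (n, j) = cj (v $ j)"
  "border n C v a $$ (n, n) = a"
  by (simp_all add: border_def)

lemma border_in_X:
  assumes "C \<in> X n" "a \<in> K"
  shows "border n C v a \<in> X (Suc n)"
  unfolding hermitian_mats_def
proof (intro CollectI conjI allI impI)
  fix i j assume "i < Suc n" "j < Suc n"
  then show "border n C v a $$ (i, j) = cj (border n C v a $$ (j, i))"
    using X_index[OF assms(1), of i j] assms(2) by (auto simp: less_Suc_eq border_index K_def)
qed (rule border_carrier)

lemma bij_betw_border:
  "bij_betw (\<lambda>(C, v, a). border n C v a) (X n \<times> V n \<times> K) (X (Suc n))"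
proof (rule bij_betw_byWitness[where f' =
      "\<lambda>D. (mat n n (($$) D), vec n (\<lambda>i. D $$ (i, n)), D $$ (n, n))"])
  show "\<forall>p\<in>X n \<times> V n \<times> K.
      (mat n n (($$) (case p of (C, v, a) \<Rightarrow> border n C v a)),
       vec n (\<lambda>i. (case p of (C, v, a) \<Rightarrow> border n C v a) $$ (i, n)),
       (case p of (C, v, a) \<Rightarrow> border n C v a) $$ (n, n)) = p"
    by (auto simp: border_index dest: X_carrier intro!: eq_matI eq_vecI)
  show "\<forall>D\<in>X (Suc n). (case (mat n n (($$) D), vec n (\<lambda>i. D $$ (i, n)), D $$ (n, n))
      of (C, v, a) \<Rightarrow> border n C v a) = D"
  proof
    fix D assume D: "D \<in> X (Suc n)"
    show "(case (mat n n (($$) D), vec n (\<lambda>i. D $$ (i, n)), D $$ (n, n))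
        of (C, v, a) \<Rightarrow> border n C v a) = D"
      unfolding prod.case
    proof (rule eq_matI)
      fix i j assume "i < dim_row D" "j < dim_col D"
      then have "i < Suc n" "j < Suc n" using X_carrier[OF D] by auto
      then show "border n (mat n n (($$) D)) (vec n (\<lambda>i. D $$ (i, n))) (D $$ (n, n)) $$ (i, j)
          = D $$ (i, j)"
        using X_index[OF D, of n j] by (auto simp: less_Suc_eq border_index)
    qed (use X_carrier[OF D] in \<open>auto simp: border_def\<close>)
  qed
  show "(\<lambda>(C, v, a). border n C v a) ` (X n \<times> V n \<times> K) \<subseteq> X (Suc n)"
    by (auto simp: border_in_X)
  show "(\<lambda>D. (mat n n (($$) D), vec n (\<lambda>i. D $$ (i, n)), D $$ (n, n))) ` X (Suc n)
      \<subseteq> X n \<times> V n \<times> K"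
  proof (intro image_subsetI)
    fix D assume D: "D \<in> X (Suc n)"
    have "mat n n (($$) D) \<in> X n"
      unfolding hermitian_mats_def
    proof (intro CollectI conjI allI impI)
      fix i j assume "i < n" "j < n"
      then show "mat n n (($$) D) $$ (i, j) = cj (mat n n (($$) D) $$ (j, i))"
        using X_index[OF D, of i j] by simp
    qed simp
    moreover have "D $$ (n, n) \<in> K"
      unfolding K_def mem_Collect_eq by (rule X_index[OF D, symmetric]) simp_all
    ultimately show "(mat n n (($$) D), vec n (\<lambda>i. D $$ (i, n)), D $$ (n, n)) \<in> X n \<times> V n \<times> K"
      by simp
  qed
qed

lemma X_0: "X 0 = {0\<^sub>m 0 0}"
  by (auto simp: hermitian_mats_def intro!: eq_matI)

lemma finite_X: "finite (X n)"
proof (induction n)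
  case 0
  then show ?case by (simp add: X_0)
next
  case (Suc n)
  then have "finite (X n \<times> V n \<times> K)" by (simp add: finite_carrier_vec)
  then show ?case using bij_betw_finite[OF bij_betw_border] by blast
qed

lemma sum_X_Suc:
  fixes f :: "'a mat \<Rightarrow> 'c::comm_monoid_add"
  shows "(\<Sum>D\<in>X (Suc n). f D) = (\<Sum>C\<in>X n. \<Sum>v\<in>V n. \<Sum>a\<in>K. f (border n C v a))"
  unfolding sum.reindex_bij_betw[OF bij_betw_border, symmetric]
  by (simp add: sum.cartesian_product case_prod_beta)

lemma hf_border:
  assumes C: "C \<in> X n" and x: "x \<in> V n"
  shows "hf (Suc n) (border n C v a) (vec_snoc x y)
    = hf n C x + tr (y * ip n x v) + a * (y * cj y)"
proof -
  have "hf n C x = (\<Sum>i<n. \<Sum>j<n. cj (x $ i) * C $$ (i, j) * x $ j)"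
    by (simp add: hf_def ip_mult_mat_vec[OF X_carrier[OF C] x])
  moreover have "y * ip n x v = (\<Sum>i<n. cj (x $ i) * v $ i * y)"
    by (simp add: ip_def sum_distrib_left mult_ac)
  moreover have "cj (y * ip n x v) = (\<Sum>j<n. cj y * cj (v $ j) * x $ j)"
    by (simp add: cj_ip) (simp add: ip_def sum_distrib_left mult_ac)
  ultimately show ?thesis
    unfolding tr_def hf_def ip_mult_mat_vec[OF border_carrier vec_snoc_carrier[OF x]]
    by (simp add: border_index vec_snoc_index[OF x] sum.distrib algebra_simps)
qed

lemma gauss_border:
  assumes "C \<in> X n"
  shows "gauss (Suc n) (border n C v a)
    = (\<Sum>y\<in>UNIV. \<psi> (a * (y * cj y)) * (\<Sum>x\<in>V n. \<psi> (hf n C x + tr (y * ip n x v))))"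
  unfolding gauss_def sum_carrier_vec_Suc
  by (intro sum.cong refl) (simp add: hf_border[OF assms] psi_add sum_distrib_left mult_ac)

lemma gauss_border_image:
  assumes C: "C \<in> X n" and w: "w \<in> V n" and a: "a \<in> K"
  shows "gauss (Suc n) (border n C (C *\<^sub>v w) a)
    = gauss n C * (if a = hf n C w then of_nat q ^ 2 else - of_nat q)"
proof -
  let ?v = "C *\<^sub>v w"
  have v: "?v \<in> V n" using X_carrier[OF C] w by simp
  have "\<psi> (a * (y * cj y)) * (\<Sum>x\<in>V n. \<psi> (hf n C x + tr (y * ip n x ?v)))
      = gauss n C * \<psi> ((a - hf n C w) * (y * cj y))" for y
  proof -
    \<comment> \<open>Completing the square: shifting \<open>x\<close> by \<open>y w\<close> absorbs
      the mixed term, which leaves a sum over norms of \<open>y\<close> with coefficient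
      \<open>a - hf n C w\<close>.\<close>
    have "hf n C (x + y \<cdot>\<^sub>v w) = hf n C x + tr (y * ip n x ?v) + hf n C w * (y * cj y)"
      if "x \<in> V n" for x
    proof -
      have "C *\<^sub>v (y \<cdot>\<^sub>v w) = y \<cdot>\<^sub>v ?v" using X_carrier[OF C] w by (simp add: mult_mat_vec[of _ n n])
      moreover from this have "hf n C (y \<cdot>\<^sub>v w) = hf n C w * (y * cj y)"
        using v w by (simp add: hf_def ip_smult_left ip_smult_right)
      ultimately show ?thesis
        using hf_add[OF C that, of "y \<cdot>\<^sub>v w"] v w by (simp add: ip_smult_right)
    qed
    then have "(\<Sum>x\<in>V n. \<psi> (hf n C (x + y \<cdot>\<^sub>v w)))
        = (\<Sum>x\<in>V n. \<psi> (hf n C x + tr (y * ip n x ?v))) * \<psi> (hf n C w * (y * cj y))"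
      by (simp add: psi_add sum_distrib_right)
    moreover have "gauss n C = (\<Sum>x\<in>V n. \<psi> (hf n C (x + y \<cdot>\<^sub>v w)))"
      using sum.reindex_bij_betw[OF bij_betw_add_vec, of "y \<cdot>\<^sub>v w" n "\<lambda>x. \<psi> (hf n C x)"] w
      by (simp add: gauss_def)
    moreover have "\<psi> (a * (y * cj y)) = \<psi> (hf n C w * (y * cj y)) * \<psi> ((a - hf n C w) * (y * cj y))"
      by (simp add: left_diff_distrib flip: psi_add)
    ultimately show ?thesis by simp
  qed
  then have "gauss (Suc n) (border n C ?v a)
      = gauss n C * (\<Sum>y\<in>UNIV. \<psi> ((a - hf n C w) * (y * cj y)))"
    by (simp add: gauss_border[OF C] sum_distrib_left)
  also have "a - hf n C w \<in> K" using hf_in_K[OF C w] a by (simp add: K_def)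
  then have "(\<Sum>y\<in>UNIV. \<psi> ((a - hf n C w) * (y * cj y)))
      = (if a = hf n C w then of_nat q ^ 2 else - of_nat q)"
    by (simp add: sum_psi_norm)
  finally show ?thesis .
qed

text \<open>For each nonzero \<open>y\<close>, shifting \<open>x\<close> by a suitable kernel vector
  preserves the form and multiplies the inner sum by \<open>\<psi> 1\<close>; so only
  \<open>y = 0\<close> contributes.\<close>

lemma gauss_border_not_image:
  assumes C: "C \<in> X n" and v: "v \<in> V n - perp_ker n C"
  shows "gauss (Suc n) (border n C v a) = gauss n C"
proof -
  have "(\<Sum>x\<in>V n. \<psi> (hf n C x + tr (y * ip n x v))) = 0" if "y \<noteq> 0" for y
  proof -
    from ex_ker_tr_ip_eq_1[OF C v that]
    obtain z where z: "z \<in> ker n C" "tr (y * ip n z v) = 1" by auto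
    then have zV: "z \<in> V n" "C *\<^sub>v z = 0\<^sub>v n" by (auto simp: ker_def)
    have "\<psi> (hf n C (x + z) + tr (y * ip n (x + z) v)) = \<psi> 1 * \<psi> (hf n C x + tr (y * ip n x v))"
      if x: "x \<in> V n" for x
    proof -
      have "hf n C (x + z) = hf n C x" using hf_add[OF C x zV(1)] zV by (simp add: hf_def)
      moreover have "tr (y * ip n (x + z) v) = tr (y * ip n x v) + 1"
        using z(2) by (simp add: ip_add_left[OF x zV(1)] distrib_left tr_add)
      ultimately show ?thesis by (simp add: psi_add)
    qed
    then show ?thesis by (rule sum_eq_0_by_shift[OF bij_betw_add_vec[OF zV(1)] _ psi_1])
  qed
  then show ?thesis
    unfolding gauss_border[OF C]
    by (subst sum.remove[of _ "0 :: 'a"]) (auto simp: gauss_def)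
qed

text \<open>A vector in the image admits one corner entry with factor \<open>q^2\<close> and
  \<open>q - 1\<close> entries with factor \<open>- q\<close>; for any other vector all
  \<open>q\<close> corner entries leave the Gauss sum unchanged.\<close>

lemma sum_gauss_border:
  fixes f :: "complex \<Rightarrow> real"
  assumes C: "C \<in> X n"
  defines "g \<equiv> gauss n C" and "m \<equiv> real (card (perp_ker n C))"
  shows "(\<Sum>v\<in>V n. \<Sum>a\<in>K. f (gauss (Suc n) (border n C v a)))
    = m * (f (g * of_nat q ^ 2) + (real q - 1) * f (- g * of_nat q))
      + (real q ^ (2 * n) - m) * real q * f g"
proof -
  have sub: "perp_ker n C \<subseteq> V n" by (auto simp: perp_ker_def)
  have "(\<Sum>a\<in>K. f (gauss (Suc n) (border n C v a)))
      = f (g * of_nat q ^ 2) + (real q - 1) * f (- g * of_nat q)" if "v \<in> perp_ker n C" for v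
  proof -
    from that image_eq_perp_ker[OF C] obtain w where w: "w \<in> V n" "v = C *\<^sub>v w" by auto
    have h: "hf n C w \<in> K" using hf_in_K[OF C w(1)] .
    have "(\<Sum>a\<in>K. f (gauss (Suc n) (border n C v a)))
      = f (g * of_nat q ^ 2) + (\<Sum>a\<in>K - {hf n C w}. f (- g * of_nat q))"
      by (subst sum.remove[OF _ h]) (auto simp: w gauss_border_image[OF C] h g_def intro!: sum.cong)
    also have "card (K - {hf n C w}) = q - 1" using h by (simp add: card_K)
    then have "(\<Sum>a\<in>K - {hf n C w}. f (- g * of_nat q)) = (real q - 1) * f (- g * of_nat q)"
      using q_gt_1 by (simp add: of_nat_diff)
    finally show ?thesis .
  qed
  then have "(\<Sum>v\<in>perp_ker n C. \<Sum>a\<in>K. f (gauss (Suc n) (border n C v a)))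
      = m * (f (g * of_nat q ^ 2) + (real q - 1) * f (- g * of_nat q))"
    by (simp add: m_def)
  moreover have "(\<Sum>v\<in>V n - perp_ker n C. \<Sum>a\<in>K. f (gauss (Suc n) (border n C v a)))
      = (\<Sum>v\<in>V n - perp_ker n C. real q * f g)"
    using gauss_border_not_image[OF C] by (intro sum.cong) (auto simp: g_def card_K)
  moreover have "card (V n - perp_ker n C) = q ^ (2 * n) - card (perp_ker n C)"
    "card (perp_ker n C) \<le> q ^ (2 * n)"
    using sub card_mono[OF finite_carrier_vec sub] finite_subset[OF sub finite_carrier_vec]
    by (auto simp: card_Diff_subset card_V)
  then have "real (card (V n - perp_ker n C)) = real q ^ (2 * n) - m"
    by (simp add: m_def of_nat_diff)
  ultimately show ?thesis
    using sum.subset_diff[OF sub finite_carrier_vec, of "\<lambda>v. \<Sum>a\<in>K. f (gauss (Suc n) (border n C v a))"]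
    by simp
qed

text \<open>Starting from 1 in dimension 0, each bordering multiplies the Gauss sum by
  \<open>(- q)^2\<close>, \<open>- q\<close> or 1.\<close>

lemma gauss_power:
  assumes "C \<in> X n"
  shows "\<exists>e. gauss n C = of_real ((- real q) ^ e)"
  using assms
proof (induction n arbitrary: C)
  case 0
  have "V 0 = {0\<^sub>v 0}" by auto
  then have "gauss 0 C = 1" by (simp add: gauss_def hf_def ip_def)
  then show ?case by (intro exI[of _ 0]) simp
next
  case (Suc n)
  then have "C \<in> (\<lambda>(C, v, a). border n C v a) ` (X n \<times> V n \<times> K)"
    using bij_betw_imp_surj_on[OF bij_betw_border] by blast
  then obtain D v a where D: "D \<in> X n" "v \<in> V n" "a \<in> K" "C = border n D v a" by auto
  obtain e where e: "gauss n D = of_real ((- real q) ^ e)" using Suc.IH[OF D(1)] by blast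
  show ?case
  proof (cases "v \<in> perp_ker n D")
    case True
    then obtain w where w: "w \<in> V n" "v = D *\<^sub>v w" using image_eq_perp_ker[OF D(1)] by auto
    show ?thesis
    proof (cases "a = hf n D w")
      case True
      then show ?thesis
        using gauss_border_image[OF D(1) w(1) D(3)] D(4) w(2) e
        by (intro exI[of _ "e + 2"]) (simp add: power_add power2_eq_square)
    next
      case False
      then show ?thesis
        using gauss_border_image[OF D(1) w(1) D(3)] D(4) w(2) e
        by (intro exI[of _ "e + 1"]) (simp add: power_add)
    qed
  next
    case False
    then show ?thesis using gauss_border_not_image[OF D(1)] D e by auto
  qed
qed

text \<open>With the base \<open>- q\<close> already known, the absolute value from
  \<open>gauss_mult_cnj\<close> determines the exponent. Here \<open>N\<close> is the dimension of
  the kernel.\<close>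

lemma gauss_eq:
  assumes C: "C \<in> X n"
  shows "\<exists>N\<le>n. gauss n C = of_real ((- real q) ^ (n + N)) \<and> card (ker n C) = q ^ (2 * N)"
proof -
  obtain e where e: "gauss n C = of_real ((- real q) ^ e)" using gauss_power[OF C] by blast
  have "gauss n C * cnj (gauss n C) = of_real (real q ^ (2 * e))"
    by (simp add: e power_mult power2_eq_square flip: power_mult_distrib)
  with gauss_mult_cnj[OF C] have "complex_of_nat (q ^ (2 * e)) = of_nat (q ^ (2 * n) * card (ker n C))"
    by simp
  then have eq: "q ^ (2 * e) = q ^ (2 * n) * card (ker n C)" by (simp only: of_nat_eq_iff)
  have pos: "card (ker n C) > 0" using zero_in_ker[OF C] by (auto simp: card_gt_0_iff)
  then have "q ^ (2 * n) \<le> q ^ (2 * e)" by (simp add: eq)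
  then have "n \<le> e" using q_gt_1 by simp
  then obtain N where N: "e = n + N" using le_Suc_ex by blast
  have ker: "card (ker n C) = q ^ (2 * N)" using eq q_gt_1 by (simp add: N distrib_left power_add)
  have "card (ker n C) \<le> card (V n)"
    by (rule card_mono[OF finite_carrier_vec]) (auto simp: ker_def)
  then have "N \<le> n" using q_gt_1 by (simp add: ker card_V)
  then show ?thesis using e N ker by auto
qed

end

subsection \<open>Moments of the rank distribution\<close>

text \<open>The analogue of the falling factorial for the base \<open>b\<close>: it vanishes at the
  first \<open>r\<close> powers of \<open>b\<close>, and its sums over all Hermitian matrices have a
  product formula.\<close>

definition qprod :: "real \<Rightarrow> nat \<Rightarrow> real \<Rightarrow> real" where
  "qprod b r z = (\<Prod>s<r. z - b ^ s)"

lemma qprod_0 [simp]: "qprod b 0 z = 1"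
  by (simp add: qprod_def)

lemma qprod_Suc: "qprod b (Suc r) z = qprod b r z * (z - b ^ r)"
  by (simp add: qprod_def)

lemma qprod_eq_0: "N < r \<Longrightarrow> qprod b r (b ^ N) = 0"
  by (auto simp: qprod_def)

text \<open>For \<open>s > 0\<close> the factor \<open>b z - b^s\<close> is \<open>b\<close> times
  \<open>z - b^(s-1)\<close>; the factor for \<open>s = 0\<close> is left over.\<close>

lemma qprod_mult_base: "qprod b (Suc r) (b * z) = (b * z - 1) * b ^ r * qprod b r z"
proof (induction r)
  case (Suc r)
  show ?case
    unfolding qprod_Suc[of b "Suc r" "b * z"] Suc.IH qprod_Suc[of b r z] by (simp add: algebra_simps)
qed (simp add: qprod_Suc)

lemma qprod_divide_base:
  assumes "b \<noteq> 0"
  shows "(z - 1) * qprod b r (z / b) * b ^ r = qprod b (Suc r) z"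
  using qprod_mult_base[of b r "z / b"] assms by (simp add: mult_ac)

text \<open>The left-hand side is, up to a power of \<open>b\<close>, the sum of \<open>qprod b (Suc r)\<close> over all borderings of
  one matrix: \<open>b * z\<close>, \<open>z\<close> and \<open>z / b\<close> are the possible new values of \<open>z\<close>.\<close>

lemma qprod_border_identity:
  assumes b: "b \<noteq> 0" and z: "z \<noteq> 0"
  shows "(B / z ^ 2 * (qprod b (Suc r) (b * z) + (- b - 1) * qprod b (Suc r) z)
      + (B - B / z ^ 2) * - b * qprod b (Suc r) (z / b)) * b ^ Suc r
    = - b * B * (qprod b (Suc r) z + (1 - b ^ Suc r) * qprod b r z)"
proof -
  define P W c where "P = qprod b r z" and "W = qprod b (Suc r) (z / b)" and "c = b ^ r"
  \<comment> \<open>The value at \<open>z / b\<close> enters only through \<open>(z - 1) W\<close>,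
    and the factor \<open>z - 1\<close> is supplied by \<open>z^2 - 1\<close>; so
    \<open>z = 1\<close> is not a separate case.\<close>
  have W: "(z - 1) * W * (b * c) = P * (z - c) * (z - b * c)"
    using qprod_divide_base[OF b, of z "Suc r"] by (simp add: qprod_Suc P_def W_def c_def)
  have "(((b * z - 1) * c * P + (- b - 1) * (P * (z - c))) + (z ^ 2 - 1) * - b * W) * (b * c)
      = ((b * z - 1) * c * P + (- b - 1) * (P * (z - c))) * (b * c) - b * (z + 1) * ((z - 1) * W * (b * c))"
    by (simp add: algebra_simps power2_eq_square)
  also have "\<dots> = - b * z ^ 2 * (P * (z - c) + (1 - b * c) * P)"
    unfolding W by (simp add: algebra_simps power2_eq_square)
  finally have *: "(((b * z - 1) * c * P + (- b - 1) * (P * (z - c))) + (z ^ 2 - 1) * - b * W) * (b * c)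
      = - b * z ^ 2 * (P * (z - c) + (1 - b * c) * P)" .
  have "(B / z ^ 2 * ((b * z - 1) * c * P + (- b - 1) * (P * (z - c))) + (B - B / z ^ 2) * - b * W) * (b * c)
      = B / z ^ 2 * ((((b * z - 1) * c * P + (- b - 1) * (P * (z - c))) + (z ^ 2 - 1) * - b * W) * (b * c))"
    using z by (simp add: field_simps)
  also have "\<dots> = - b * B * (P * (z - c) + (1 - b * c) * P)"
    unfolding * using z by simp
  finally show ?thesis
    unfolding qprod_mult_base qprod_Suc[of b r z] P_def W_def c_def by simp
qed

section \<open>Recurrence and closed form for the moments\<close>

context hermitian_forms
begin

abbreviation b :: real where "b \<equiv> - real q"

text \<open>The Gauss sum of a matrix of rank \<open>k\<close> is \<open>b ^ (2 * n - k)\<close>, so that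
  \<open>zeta n C = b ^ (n - k)\<close>; the rank itself is never needed.\<close>

definition zeta :: "nat \<Rightarrow> 'a mat \<Rightarrow> real" where
  "zeta n C = Re (gauss n C) / b ^ n"

lemma b_nonzero: "b \<noteq> 0"
  using q_gt_1 by simp

lemma gauss_eq_zeta:
  assumes "C \<in> X n"
  shows "gauss n C = of_real (b ^ n * zeta n C)"
  using gauss_eq[OF assms] b_nonzero by (auto simp: zeta_def simp flip: of_real_power of_real_minus)

lemma zeta_power:
  assumes "C \<in> X n"
  shows "\<exists>N\<le>n. zeta n C = b ^ N"
  using gauss_eq[OF assms] b_nonzero by (auto simp: zeta_def power_add)

lemma card_perp_ker_zeta:
  assumes C: "C \<in> X n"
  shows "real (card (perp_ker n C)) = b ^ (2 * n) / zeta n C ^ 2" and "zeta n C \<noteq> 0"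
proof -
  obtain N where N: "gauss n C = of_real (b ^ (n + N))" "card (ker n C) = q ^ (2 * N)"
    using gauss_eq[OF C] by blast
  then have z: "zeta n C = b ^ N" using b_nonzero by (simp add: zeta_def power_add del: of_real_power)
  then show "zeta n C \<noteq> 0" using b_nonzero by simp
  have "real (card (perp_ker n C)) * real q ^ (2 * N) = real q ^ (2 * n)"
    using card_perp_ker[OF C] N(2) by (metis of_nat_mult of_nat_power)
  then show "real (card (perp_ker n C)) = b ^ (2 * n) / zeta n C ^ 2"
    using q_gt_1 by (simp add: z field_simps flip: power_mult)
qed

text \<open>Moments of the rank distribution in the \<open>qprod\<close> basis; the final weight
  involves only the orders \<open>d - 2\<close> and \<open>d - 1\<close>.\<close>

definition S :: "nat \<Rightarrow> nat \<Rightarrow> real" where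
  "S n r = (\<Sum>C\<in>X n. qprod b r (zeta n C))"

text \<open>Normalising in dimension \<open>n + 1\<close> divides by one more \<open>b\<close>, so
  the factors \<open>q^2\<close>, \<open>- q\<close> and 1 of the Gauss sum become \<open>b\<close>,
  1 and \<open>1 / b\<close>. The multiplicities \<open>q - 1\<close> and \<open>q\<close> are
  written \<open>- b - 1\<close> and \<open>- b\<close>.\<close>

lemma sum_zeta_border:
  fixes f :: "real \<Rightarrow> real"
  assumes C: "C \<in> X n"
  defines "z \<equiv> zeta n C"
  shows "(\<Sum>v\<in>V n. \<Sum>a\<in>K. f (zeta (Suc n) (border n C v a)))
    = b ^ (2 * n) / z ^ 2 * (f (b * z) + (- b - 1) * f z)
      + (b ^ (2 * n) - b ^ (2 * n) / z ^ 2) * - b * f (z / b)"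
proof -
  have g: "gauss n C = of_real (b ^ n * z)" using gauss_eq_zeta[OF C] by (simp add: z_def)
  have "Re (gauss n C * of_nat q ^ 2) / b ^ Suc n = b * z"
    "Re (- gauss n C * of_nat q) / b ^ Suc n = z" "Re (gauss n C) / b ^ Suc n = z / b"
    using q_gt_1 by (simp_all add: g Re_power2 power2_eq_square del: of_real_power of_real_mult)
  moreover have "real q ^ (2 * n) = b ^ (2 * n)" by simp
  ultimately show ?thesis
    using sum_gauss_border[OF C, of "\<lambda>g. f (Re g / b ^ Suc n)"] card_perp_ker_zeta(1)[OF C]
    by (simp only: zeta_def[of "Suc n"] z_def[symmetric]) simp
qed

lemma S_Suc_Suc:
  "S (Suc n) (Suc r) * b ^ Suc r = - (b ^ Suc (2 * n)) * (S n (Suc r) + (1 - b ^ Suc r) * S n r)"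
proof -
  have "S (Suc n) (Suc r) * b ^ Suc r
      = (\<Sum>C\<in>X n. - b * b ^ (2 * n) * (qprod b (Suc r) (zeta n C) + (1 - b ^ Suc r) * qprod b r (zeta n C)))"
    unfolding S_def sum_X_Suc sum_distrib_right[of _ "X n"]
    by (intro sum.cong refl, subst sum_zeta_border, assumption,
        rule qprod_border_identity[OF b_nonzero card_perp_ker_zeta(2)])
  then show ?thesis by (simp add: S_def sum.distrib sum_distrib_left distrib_left mult.assoc)
qed

lemma S_Suc_0: "S (Suc n) 0 = - (b ^ Suc (2 * n)) * S n 0"
  unfolding S_def sum_X_Suc by (simp add: card_K card_V mult_ac)

text \<open>Induction on \<open>n\<close> through the two-term recurrence, for all \<open>r\<close>
  at once. The factor \<open>b ^ (n * r)\<close> on the left avoids negative exponents when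
  \<open>r > n\<close>, where both sides vanish.\<close>

lemma S_closed_form: "S n r * b ^ (n * r) = (- 1) ^ (n + r) * b ^ (n ^ 2) * qprod b r (b ^ n)"
proof (induction n arbitrary: r)
  case 0
  have "zeta 0 (0\<^sub>m 0 0) = 1" using zeta_power[of "0\<^sub>m 0 0" 0] by (simp add: X_0)
  moreover have "qprod b r 1 = (if r = 0 then 1 else 0)"
    by (auto simp: qprod_def intro!: bexI[of _ 0])
  ultimately show ?case by (simp add: S_def X_0)
next
  case (Suc n)
  have "(Suc n)\<^sup>2 = Suc (2 * n) + n\<^sup>2" by (simp add: power2_eq_square)
  then have sq: "b ^ (Suc n)\<^sup>2 = b ^ Suc (2 * n) * b ^ n\<^sup>2" by (simp only: power_add)
  show ?case
  proof (cases r)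
    case 0
    then show ?thesis using Suc[of 0] unfolding sq by (simp add: S_Suc_0)
  next
    case (Suc r')
    let ?p = "qprod b r' (b ^ n)"
    have "S (Suc n) r * b ^ (Suc n * r) = S (Suc n) (Suc r') * b ^ Suc r' * b ^ (n * Suc r')"
      by (simp add: Suc power_add mult_ac)
    also have "\<dots> = - (b ^ Suc (2 * n)) * (S n (Suc r') * b ^ (n * Suc r')
        + (1 - b ^ Suc r') * b ^ n * (S n r' * b ^ (n * r')))"
      unfolding S_Suc_Suc by (simp add: power_add algebra_simps)
    also have "\<dots> = - (b ^ Suc (2 * n)) * ((- 1) ^ (n + Suc r') * b ^ n\<^sup>2 * (?p * (b ^ n - b ^ r'))
        + (1 - b ^ Suc r') * b ^ n * ((- 1) ^ (n + r') * b ^ n\<^sup>2 * ?p))"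
      unfolding Suc.IH qprod_Suc ..
    \<comment> \<open>The two summands carry opposite signs, and
      \<open>b^n - b^r' - (1 - b^(r'+1)) b^n = b^r' (b b^n - 1)\<close>.\<close>
    also have "\<dots> = (- 1) ^ (Suc n + r) * b ^ (Suc n)\<^sup>2 * ((b * b ^ n - 1) * b ^ r' * ?p)"
      unfolding sq Suc by (simp add: algebra_simps)
    also have "\<dots> = (- 1) ^ (Suc n + r) * b ^ (Suc n)\<^sup>2 * qprod b r (b ^ Suc n)"
      unfolding Suc power_Suc[of b n] qprod_mult_base ..
    finally show ?thesis .
  qed
qed

end

subsection \<open>Fourier transforms and the linear programming bound\<close>

text \<open>A sum of \<open>t\<close> outer products, each of rank at most 1. It will bound the rank
  of Gram matrices.\<close>

lemma mrank_sum_products_le: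
  fixes f g :: "nat \<Rightarrow> nat \<Rightarrow> 'b::field"
  shows "mrank n (mat n n (\<lambda>(i, j). \<Sum>s<t. f s i * g s j)) \<le> t"
proof (induction t)
  case 0
  have "mat n n (\<lambda>(i, j). \<Sum>s<0. f s i * g s j) = 0\<^sub>m n n" by (auto intro!: eq_matI)
  then show ?case by (simp only: mrank_def vec_space.rank_0I le_refl)
next
  case (Suc t)
  let ?M = "\<lambda>t. mat n n (\<lambda>(i, j). \<Sum>s<t. f s i * g s j)" and ?E = "mat n n (\<lambda>(i, j). f t i * g t j)"
  have "?M (Suc t) = ?M t + ?E" by (auto intro!: eq_matI)
  moreover have "mrank n (?M t + ?E) \<le> mrank n (?M t) + mrank n ?E"
    unfolding mrank_def by (rule vec_space.rank_subadditive[where nc = n]) auto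
  moreover have "mrank n ?E \<le> 1"
    unfolding mrank_def by (rule vec_space.rank_le_1_product_entries[where nc = n and f = "f t" and g = "g t"]) auto
  ultimately show ?case using Suc by simp
qed

section \<open>Characters of the additive group of Hermitian matrices\<close>

context hermitian_forms
begin

text \<open>The trace of \<open>A\<close> times the transpose of \<open>C\<close>. Without a
  conjugate, pairing the matrix with entries \<open>cj (x $ i) * x $ j\<close> with \<open>C\<close>
  gives exactly \<open>hf n C x\<close>.\<close>

definition pr :: "nat \<Rightarrow> 'a mat \<Rightarrow> 'a mat \<Rightarrow> 'a" where
  "pr n A C = (\<Sum>i<n. \<Sum>j<n. A $$ (i, j) * C $$ (i, j))"

lemma pr_add_left:
  "A \<in> carrier_mat n n \<Longrightarrow> B \<in> carrier_mat n n \<Longrightarrow> pr n (A + B) C = pr n A C + pr n B C"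
  by (simp add: pr_def sum.distrib distrib_right)

lemma pr_diff_left:
  "A \<in> carrier_mat n n \<Longrightarrow> B \<in> carrier_mat n n \<Longrightarrow> pr n (A - B) C = pr n A C - pr n B C"
  by (simp add: pr_def sum_subtractf left_diff_distrib)

lemma pr_add_right:
  "C \<in> carrier_mat n n \<Longrightarrow> D \<in> carrier_mat n n \<Longrightarrow> pr n A (C + D) = pr n A C + pr n A D"
  by (simp add: pr_def sum.distrib distrib_left)

lemma X_add:
  assumes "A \<in> X n" "B \<in> X n"
  shows "A + B \<in> X n"
  unfolding hermitian_mats_def
proof (intro CollectI conjI allI impI)
  fix i j assume "i < n" "j < n"
  then show "(A + B) $$ (i, j) = cj ((A + B) $$ (j, i))"
    using X_index[OF assms(1), of i j] X_index[OF assms(2), of i j] X_carrier[OF assms(1)] X_carrier[OF assms(2)]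
    by simp
qed (use assms in \<open>auto dest: X_carrier\<close>)

lemma X_diff:
  assumes "A \<in> X n" "B \<in> X n"
  shows "A - B \<in> X n"
  unfolding hermitian_mats_def
proof (intro CollectI conjI allI impI)
  fix i j assume "i < n" "j < n"
  then show "(A - B) $$ (i, j) = cj ((A - B) $$ (j, i))"
    using X_index[OF assms(1), of i j] X_index[OF assms(2), of i j] X_carrier[OF assms(1)] X_carrier[OF assms(2)]
    by simp
qed (use assms(2) X_carrier minus_carrier_mat in blast)

lemma zero_in_X: "0\<^sub>m n n \<in> X n"
  by (simp add: hermitian_mats_def)

lemma bij_betw_add_X:
  assumes E: "E \<in> X n"
  shows "bij_betw (\<lambda>C. C + E) (X n) (X n)"
proof (rule bij_betw_byWitness[where f' = "\<lambda>C. C - E"])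
  show "\<forall>C\<in>X n. C + E - E = C" "\<forall>C\<in>X n. C - E + E = C"
    using X_carrier[OF E] by (auto dest!: X_carrier intro!: eq_matI)
qed (use E in \<open>auto simp: X_add X_diff\<close>)

text \<open>A nonzero entry of \<open>D\<close> yields a Hermitian matrix \<open>E\<close> supported
  at that position and its mirror with \<open>pr n D E = 1\<close>; translation by \<open>E\<close>
  then kills the sum.\<close>

lemma sum_psi_pr:
  assumes D: "D \<in> X n" and "D \<noteq> 0\<^sub>m n n"
  shows "(\<Sum>C\<in>X n. \<psi> (pr n D C)) = 0"
proof -
  obtain i j where ij: "i < n" "j < n" "D $$ (i, j) \<noteq> 0"
    using assms X_carrier[OF D] by (metis carrier_matD eq_matI index_zero_mat)
  obtain s where s: "tr (s * D $$ (i, j)) = 1" using ex_trace_eq_1[OF ij(3)] by (auto simp: tr_def)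
  \<comment> \<open>The two contributions are added, so that for \<open>i = j\<close> the diagonal
    entry becomes the trace of \<open>s\<close> and no case distinction arises.\<close>
  define E where "E = mat n n (\<lambda>(k, l). (if k = i then if l = j then s else 0 else 0)
      + (if k = j then if l = i then cj s else 0 else 0))"
  have E: "E \<in> X n"
    unfolding hermitian_mats_def E_def by (auto simp: add.commute)
  have delta: "(\<Sum>l<n. if k = k' then if l = l' then c else 0 else 0) = (if k = k' then c else 0)"
    if "l' < n" for k k' l' and c :: 'a using that by (cases "k = k'") auto
  have "pr n D E = (\<Sum>k<n. \<Sum>l<n. (if k = i then if l = j then D $$ (i, j) * s else 0 else 0)
      + (if k = j then if l = i then D $$ (j, i) * cj s else 0 else 0))"
    unfolding pr_def E_def by (intro sum.cong refl) (auto simp: distrib_left)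
  also have "\<dots> = D $$ (i, j) * s + D $$ (j, i) * cj s"
    using ij by (simp add: sum.distrib delta)
  also have "\<dots> = 1" using s X_index[OF D ij(2,1)] by (simp add: tr_def mult.commute)
  finally have "pr n D E = 1" .
  then have "\<psi> (pr n D (C + E)) = \<psi> 1 * \<psi> (pr n D C)" if "C \<in> X n" for C
    using pr_add_right[OF X_carrier[OF that] X_carrier[OF E]] by (simp add: psi_add)
  then show ?thesis by (rule sum_eq_0_by_shift[OF bij_betw_add_X[OF E] _ psi_1])
qed

text \<open>Expanding the power gives a sum over \<open>t\<close>-tuples of vectors, and the sum of
  the \<open>t\<close> form values is the pairing of \<open>C\<close> with the Gram matrix of the
  coordinates.\<close>

lemma gauss_power_eq_sum:
  assumes C: "C \<in> X n"
  shows "gauss n C ^ t = (\<Sum>x\<in>{..<t} \<rightarrow>\<^sub>E V n.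
    \<psi> (pr n (mat n n (\<lambda>(i, j). \<Sum>s<t. cj (x s $ i) * x s $ j)) C))"
proof -
  have "gauss n C ^ t = (\<Prod>s<t. \<Sum>x\<in>V n. \<psi> (hf n C x))"
    by (simp add: gauss_def)
  also have "\<dots> = (\<Sum>x\<in>{..<t} \<rightarrow>\<^sub>E V n. \<Prod>s<t. \<psi> (hf n C (x s)))"
    by (intro prod_sum_PiE) (auto simp: finite_carrier_vec)
  also have "\<dots> = (\<Sum>x\<in>{..<t} \<rightarrow>\<^sub>E V n.
      \<psi> (pr n (mat n n (\<lambda>(i, j). \<Sum>s<t. cj (x s $ i) * x s $ j)) C))"
  proof (intro sum.cong refl)
    fix x assume "x \<in> {..<t} \<rightarrow>\<^sub>E V n"
    then have x: "x s \<in> V n" if "s < t" for s using that by auto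
    have "(\<Sum>s<t. hf n C (x s)) = (\<Sum>s<t. \<Sum>i<n. \<Sum>j<n. cj (x s $ i) * x s $ j * C $$ (i, j))"
      using x by (intro sum.cong) (auto simp: hf_def ip_mult_mat_vec[OF X_carrier[OF C]] mult_ac)
    also have "\<dots> = (\<Sum>i<n. \<Sum>s<t. \<Sum>j<n. cj (x s $ i) * x s $ j * C $$ (i, j))"
      by (rule sum.swap)
    also have "\<dots> = (\<Sum>i<n. \<Sum>j<n. \<Sum>s<t. cj (x s $ i) * x s $ j * C $$ (i, j))"
      by (rule sum.cong[OF refl], rule sum.swap)
    also have "\<dots> = pr n (mat n n (\<lambda>(i, j). \<Sum>s<t. cj (x s $ i) * x s $ j)) C"
      by (simp add: pr_def sum_distrib_right)
    finally show "(\<Prod>s<t. \<psi> (hf n C (x s)))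
        = \<psi> (pr n (mat n n (\<lambda>(i, j). \<Sum>s<t. cj (x s $ i) * x s $ j)) C)"
      by (simp flip: psi_sum)
  qed
  finally show ?thesis .
qed

text \<open>Each tuple contributes the character sum for its Gram matrix plus \<open>D\<close>. The
  Gram matrix has rank at most \<open>t\<close>, less than the rank of \<open>D\<close>, so this
  matrix is never zero.\<close>

lemma fourier_gauss_power_eq_0:
  assumes D: "D \<in> X n" and t: "t < mrank n D"
  shows "(\<Sum>C\<in>X n. gauss n C ^ t * \<psi> (pr n D C)) = 0"
proof -
  let ?M = "\<lambda>x. mat n n (\<lambda>(i, j). \<Sum>s<t. cj (x s $ i) * x s $ j)"
  have "(\<Sum>C\<in>X n. gauss n C ^ t * \<psi> (pr n D C))
      = (\<Sum>C\<in>X n. \<Sum>x\<in>{..<t} \<rightarrow>\<^sub>E V n. \<psi> (pr n (?M x + D) C))"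
    using X_carrier[OF D]
    by (intro sum.cong refl) (simp add: gauss_power_eq_sum sum_distrib_right pr_add_left psi_add)
  also have "\<dots> = (\<Sum>x\<in>{..<t} \<rightarrow>\<^sub>E V n. \<Sum>C\<in>X n. \<psi> (pr n (?M x + D) C))"
    by (rule sum.swap)
  also have "\<dots> = 0"
  proof (rule sum.neutral, rule ballI, rule sum_psi_pr)
    fix x assume "x \<in> {..<t} \<rightarrow>\<^sub>E V n"
    have "?M x \<in> X n" by (auto simp: hermitian_mats_def cj_sum mult.commute)
    then show "?M x + D \<in> X n" using D by (rule X_add)
    show "?M x + D \<noteq> 0\<^sub>m n n"
    proof
      assume *: "?M x + D = 0\<^sub>m n n"
      \<comment> \<open>If the sum were zero, \<open>D\<close> would be a sum of \<open>t\<close>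
        outer products, the minus sign being absorbed into the first factors.\<close>
      have "D = mat n n (\<lambda>(i, j). \<Sum>s<t. - cj (x s $ i) * x s $ j)"
      proof (rule eq_matI)
        fix i j assume "i < dim_row (mat n n (\<lambda>(i, j). \<Sum>s<t. - cj (x s $ i) * x s $ j))"
          "j < dim_col (mat n n (\<lambda>(i, j). \<Sum>s<t. - cj (x s $ i) * x s $ j))"
        then have ij: "i < n" "j < n" by auto
        then have "?M x $$ (i, j) + D $$ (i, j) = 0"
          using arg_cong[OF *, of "\<lambda>M. M $$ (i, j)"] X_carrier[OF D] by simp
        then show "D $$ (i, j) = mat n n (\<lambda>(i, j). \<Sum>s<t. - cj (x s $ i) * x s $ j) $$ (i, j)"
          using ij by (simp add: sum_negf add_eq_0_iff)
      qed (use X_carrier[OF D] in auto)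
      then show False using mrank_sum_products_le[of n "\<lambda>s i. - cj (x s $ i)" "\<lambda>s j. x s $ j" t] t
        by (metis not_le)
    qed
  qed
  finally show ?thesis .
qed

text \<open>On Hermitian matrices \<open>zeta\<close> is the Gauss sum divided by
  \<open>b^n\<close>, so this is a linear combination of the vanishing transforms for
  \<open>t\<close> up to the degree.\<close>

lemma fourier_poly_zeta_eq_0:
  assumes D: "D \<in> X n" and P: "degree P < mrank n D"
  shows "(\<Sum>C\<in>X n. of_real (poly P (zeta n C)) * \<psi> (pr n D C)) = 0"
proof -
  have "(\<Sum>C\<in>X n. of_real (poly P (zeta n C)) * \<psi> (pr n D C))
      = (\<Sum>C\<in>X n. \<Sum>t\<le>degree P. of_real (coeff P t / b ^ (n * t)) * (gauss n C ^ t * \<psi> (pr n D C)))"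
  proof (intro sum.cong refl)
    fix C assume C: "C \<in> X n"
    have "complex_of_real (coeff P t * zeta n C ^ t) = of_real (coeff P t / b ^ (n * t)) * gauss n C ^ t" for t
      using b_nonzero
      by (simp add: gauss_eq_zeta[OF C] power_mult_distrib flip: power_mult of_real_power of_real_mult of_real_divide)
    then show "of_real (poly P (zeta n C)) * \<psi> (pr n D C)
      = (\<Sum>t\<le>degree P. of_real (coeff P t / b ^ (n * t)) * (gauss n C ^ t * \<psi> (pr n D C)))"
      by (simp add: poly_altdef sum_distrib_right mult.assoc flip: of_real_mult)
  qed
  also have "\<dots> = (\<Sum>t\<le>degree P. of_real (coeff P t / b ^ (n * t)) * (\<Sum>C\<in>X n. gauss n C ^ t * \<psi> (pr n D C)))"
    by (subst sum.swap) (simp add: sum_distrib_left)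
  also have "\<dots> = 0" using P by (intro sum.neutral) (auto simp: fourier_gauss_power_eq_0[OF D])
  finally show ?thesis .
qed

lemma zeta_zero_mat: "zeta n (0\<^sub>m n n) = b ^ n"
proof -
  have "hf n (0\<^sub>m n n) x = 0" if "x \<in> V n" for x
    using that by (simp add: hf_def ip_mult_mat_vec)
  then have "gauss n (0\<^sub>m n n) = of_nat (q ^ (2 * n))"
    by (simp add: gauss_def card_V)
  then have "zeta n (0\<^sub>m n n) = real (q ^ (2 * n)) / b ^ n"
    by (simp add: zeta_def del: of_nat_power)
  also have "real (q ^ (2 * n)) = b ^ n * b ^ n"
    by (simp add: power_mult power2_eq_square flip: power_mult_distrib)
  finally show ?thesis using b_nonzero by simp
qed

text \<open>The sum of \<open>c C\<close> times the squared modulus of \<open>F C\<close> is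
  evaluated twice. Expanded over pairs in \<open>Y\<close>, only the diagonal survives, because
  distinct codewords differ by rank at least \<open>d\<close>. From below, nonnegativity lets all
  terms except that of the zero matrix be dropped.\<close>

lemma delsarte_bound:
  fixes Y :: "'a mat set"
  assumes Y: "is_d_code n q d Y" and P: "degree P < d"
    and nonneg: "\<And>C. C \<in> X n \<Longrightarrow> poly P (zeta n C) \<ge> 0"
  shows "real (card Y) * poly P (b ^ n) \<le> (\<Sum>C\<in>X n. poly P (zeta n C))"
proof -
  have sub: "Y \<subseteq> X n" and "Y \<noteq> {}" using Y by (auto simp: is_d_code_def)
  then have fin: "finite Y" "card Y > 0" using finite_subset[OF sub finite_X] by (auto simp: card_gt_0_iff)
  define c where "c C = poly P (zeta n C)" for C
  define F where "F C = (\<Sum>A\<in>Y. \<psi> (pr n A C))" for C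
  have vanish: "(\<Sum>C\<in>X n. of_real (c C) * \<psi> (pr n (A - B) C)) = (if A = B then of_real (\<Sum>C\<in>X n. c C) else 0)"
    if "A \<in> Y" "B \<in> Y" for A B
  proof (cases "A = B")
    case True
    have "A \<in> carrier_mat n n" using that(1) sub X_carrier by blast
    then have "pr n (A - A) C = 0" for C by (simp only: pr_diff_left) simp
    then show ?thesis using True by simp
  next
    case False
    then have "degree P < mrank n (A - B)" using Y P that by (auto simp: is_d_code_def intro: less_le_trans)
    then show ?thesis
      unfolding c_def using False that sub by (auto intro!: fourier_poly_zeta_eq_0 X_diff)
  qed
  have "(\<Sum>C\<in>X n. of_real (c C) * (F C * cnj (F C)))
      = (\<Sum>C\<in>X n. \<Sum>A\<in>Y. \<Sum>B\<in>Y. of_real (c C) * \<psi> (pr n (A - B) C))"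
  proof (intro sum.cong refl)
    fix C
    have "F C * cnj (F C) = (\<Sum>A\<in>Y. \<Sum>B\<in>Y. \<psi> (pr n A C) * cnj (\<psi> (pr n B C)))"
      by (simp add: F_def sum_product)
    also have "\<dots> = (\<Sum>A\<in>Y. \<Sum>B\<in>Y. \<psi> (pr n (A - B) C))"
    proof (intro sum.cong refl)
      fix A B assume "A \<in> Y" "B \<in> Y"
      then have "A \<in> carrier_mat n n" "B \<in> carrier_mat n n" using sub X_carrier by blast+
      then have "pr n (A - B) C = pr n A C + - pr n B C" by (simp add: pr_diff_left)
      then show "\<psi> (pr n A C) * cnj (\<psi> (pr n B C)) = \<psi> (pr n (A - B) C)"
        by (simp only: psi_add psi_minus)
    qed
    finally show "of_real (c C) * (F C * cnj (F C)) = (\<Sum>A\<in>Y. \<Sum>B\<in>Y. of_real (c C) * \<psi> (pr n (A - B) C))"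
      by (simp add: sum_distrib_left)
  qed
  also have "\<dots> = (\<Sum>A\<in>Y. \<Sum>B\<in>Y. \<Sum>C\<in>X n. of_real (c C) * \<psi> (pr n (A - B) C))"
    by (subst sum.swap, rule sum.cong[OF refl], rule sum.swap)
  also have "\<dots> = (\<Sum>A\<in>Y. \<Sum>B\<in>Y. if A = B then of_real (\<Sum>C\<in>X n. c C) else 0)"
    by (intro sum.cong refl vanish)
  also have "\<dots> = of_real (real (card Y) * (\<Sum>C\<in>X n. c C))"
    using fin by simp
  also have "(\<Sum>C\<in>X n. of_real (c C) * (F C * cnj (F C))) = of_real (\<Sum>C\<in>X n. c C * (norm (F C))\<^sup>2)"
    by (simp add: complex_norm_square flip: of_real_power)
  finally have eq: "(\<Sum>C\<in>X n. c C * (norm (F C))\<^sup>2) = real (card Y) * (\<Sum>C\<in>X n. c C)"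
    using of_real_eq_iff by blast
  have "F (0\<^sub>m n n) = of_nat (card Y)" by (simp add: F_def pr_def)
  then have "c (0\<^sub>m n n) * (real (card Y))\<^sup>2 = c (0\<^sub>m n n) * (norm (F (0\<^sub>m n n)))\<^sup>2" by simp
  also have "\<dots> \<le> (\<Sum>C\<in>X n. c C * (norm (F C))\<^sup>2)"
    using nonneg by (intro member_le_sum zero_in_X finite_X) (auto simp: c_def)
  finally have "real (card Y) * (real (card Y) * c (0\<^sub>m n n)) \<le> real (card Y) * (\<Sum>C\<in>X n. c C)"
    unfolding eq by (simp add: power2_eq_square mult_ac)
  then show ?thesis using fin(2) by (simp add: c_def zeta_zero_mat)
qed

subsection \<open>The bound\<close>

text \<open>The factors are paired as \<open>s = 2 k\<close> and \<open>s = 2 k + 1\<close>. For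
  \<open>N\<close> at least \<open>2 k\<close> both have the same sign, according to the parity of
  \<open>N\<close>, or one is zero; for smaller \<open>N\<close> an earlier factor vanishes.\<close>

lemma qprod_power_nonneg:
  assumes "even r"
  shows "qprod b r (b ^ N) \<ge> 0"
proof -
  obtain k where r: "r = 2 * k" using assms by blast
  have "qprod b (2 * k) (b ^ N) \<ge> 0"
  proof (induction k)
    case (Suc k)
    have pair: "(b ^ N - b ^ (2 * k)) * (b ^ N - b ^ Suc (2 * k)) \<ge> 0" if N: "2 * k \<le> N"
    proof (cases "even N")
      case True
      then have "b ^ (2 * k) \<le> b ^ N" using N q_gt_1 by (simp add: power_increasing)
      moreover have "b ^ Suc (2 * k) \<le> b ^ N" using True by (simp add: mult_nonneg_nonneg order_trans[of _ 0])
      ultimately show ?thesis by simp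
    next
      case False
      then have "Suc (2 * k) \<le> N" using N by (cases "N = 2 * k") auto
      then have "real q ^ Suc (2 * k) \<le> real q ^ N" using q_gt_1 by (intro power_increasing) auto
      then have "b ^ N \<le> b ^ Suc (2 * k)" using False by simp
      moreover have "b ^ N \<le> b ^ (2 * k)" using False by (simp add: order_trans[of _ 0])
      ultimately show ?thesis by (intro mult_nonpos_nonpos) auto
    qed
    have "qprod b (2 * Suc k) (b ^ N)
        = qprod b (2 * k) (b ^ N) * ((b ^ N - b ^ (2 * k)) * (b ^ N - b ^ Suc (2 * k)))"
      by (simp add: qprod_Suc mult.assoc)
    moreover have "\<dots> \<ge> 0"
    proof (cases "2 * k \<le> N")
      case True
      then show ?thesis using Suc.IH pair by (metis mult_nonneg_nonneg)
    next
      case False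
      then show ?thesis by (simp add: qprod_eq_0)
    qed
    ultimately show ?case by simp
  qed simp
  then show ?thesis by (simp add: r)
qed

lemma qprod_power_nonzero:
  assumes "r \<le> N"
  shows "qprod b r (b ^ N) \<noteq> 0"
proof -
  have "b ^ N \<noteq> b ^ s" if "s < r" for s
  proof
    assume "b ^ N = b ^ s"
    then have "real q ^ N = real q ^ s" by (metis abs_minus_cancel abs_of_nat power_abs)
    then show False using that assms q_gt_1 by simp
  qed
  then show ?thesis by (auto simp: qprod_def)
qed

text \<open>The term with \<open>b^m\<close> contributes \<open>q^m\<close>, which dominates the
  other term for \<open>N\<close> at most \<open>m\<close>; for \<open>N = m + 1\<close> the other
  term is itself positive.\<close>

lemma signed_power_diff_nonneg:
  assumes "N \<le> Suc m"
  shows "(- 1) ^ Suc m * (b ^ N - b ^ m) \<ge> 0"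
proof -
  have m: "(- 1) ^ Suc m * b ^ m = - (real q ^ m)"
    by (simp flip: power_mult_distrib)
  show ?thesis
  proof (cases "N = Suc m")
    case True
    have "(- 1) ^ Suc m * b ^ N = real q ^ Suc m" unfolding True power_mult_distrib[symmetric] by simp
    then show ?thesis unfolding right_diff_distrib m by simp
  next
    case False
    then have "\<bar>(- 1) ^ Suc m * b ^ N\<bar> \<le> real q ^ m"
      using assms q_gt_1 by (simp add: abs_mult power_abs power_increasing)
    then show ?thesis unfolding right_diff_distrib m by linarith
  qed
qed

text \<open>The weight vanishes on matrices of rank 1 and, by \<open>qprod\<close>, on ranks above \<open>n - r\<close>; the sign
  \<open>(- 1) ^ n\<close> makes it nonnegative on the remaining ranks.\<close>

lemma code_bound:
  fixes Y :: "'a mat set"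
  assumes Y: "is_d_code n q (Suc (Suc r)) Y" and r: "even r" "Suc (Suc r) \<le> n"
  shows "real (card Y) * (b ^ n - b ^ (n - 1)) * (- 1) ^ n
    \<le> b ^ (n * (n - r - 1)) * (b ^ r - b ^ n) + (b ^ r - b ^ (n - 1)) * b ^ (n * (n - r))"
proof -
  \<comment> \<open>The degree is at most \<open>r + 1 = d - 1\<close>, within the range of
    \<open>delsarte_bound\<close>; the extra root \<open>b ^ (n - 1)\<close> is the value of
    \<open>zeta\<close> at rank 1.\<close>
  define P where "P = Polynomial.smult ((- 1) ^ n) ((\<Prod>s<r. [:- (b ^ s), 1:]) * [:- (b ^ (n - 1)), 1:])"
  have P: "poly P z = (- 1) ^ n * (qprod b r z * (z - b ^ (n - 1)))" for z
    by (simp add: P_def poly_prod qprod_def algebra_simps)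
  have "degree (\<Prod>s<r. [:- (b ^ s), 1:]) \<le> r"
    using degree_prod_sum_le[of "{..<r}" "\<lambda>s. [:- (b ^ s), 1:]"] by simp
  then have deg: "degree P < Suc (Suc r)"
    unfolding P_def using degree_mult_le[of "\<Prod>s<r. [:- (b ^ s), 1:]" "[:- (b ^ (n - 1)), 1:]"]
    by simp
  obtain m where m: "n = Suc m" using r(2) by (cases n) auto
  have nonneg: "poly P (zeta n C) \<ge> 0" if "C \<in> X n" for C
  proof -
    from zeta_power[OF that] obtain N where N: "N \<le> n" "zeta n C = b ^ N" by blast
    have "poly P (zeta n C) = qprod b r (b ^ N) * ((- 1) ^ Suc m * (b ^ N - b ^ m))"
      unfolding P N(2) by (simp add: m)
    also have "\<dots> \<ge> 0"
      using N(1) unfolding m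
      by (intro mult_nonneg_nonneg qprod_power_nonneg[OF r(1)] signed_power_diff_nonneg) simp
    finally show ?thesis .
  qed
  \<comment> \<open>This positive factor is common to both moments and to the weight at the zero
    matrix, and cancels at the end.\<close>
  let ?p = "qprod b r (b ^ n)"
  have Sr: "S n r = (- 1) ^ n * b ^ (n * (n - r)) * ?p"
  proof -
    have "n\<^sup>2 = n * (n - r) + n * r" using r(2) by (simp add: power2_eq_square flip: distrib_left)
    then have "S n r * b ^ (n * r) = ((- 1) ^ n * b ^ (n * (n - r)) * ?p) * b ^ (n * r)"
      using S_closed_form[of n r] r(1) by (simp add: power_add mult.assoc)
    then show ?thesis using b_nonzero by (metis mult_right_cancel power_not_zero)
  qed
  have Sr': "S n (Suc r) = - ((- 1) ^ n * b ^ (n * (n - r - 1)) * (?p * (b ^ n - b ^ r)))"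
  proof -
    have "n\<^sup>2 = n * (n - r - 1 + Suc r)" using r(2) by (simp add: power2_eq_square)
    then have "n\<^sup>2 = n * (n - r - 1) + n * Suc r" by (simp only: distrib_left)
    then have "S n (Suc r) * b ^ (n * Suc r)
        = - ((- 1) ^ n * b ^ (n * (n - r - 1)) * (?p * (b ^ n - b ^ r))) * b ^ (n * Suc r)"
      using S_closed_form[of n "Suc r"] r(1) by (simp only: power_add qprod_Suc) simp
    then show ?thesis using b_nonzero by (metis mult_right_cancel power_not_zero)
  qed
  \<comment> \<open>Splitting \<open>z - b^(n-1)\<close> as
    \<open>(z - b^r) + (b^r - b^(n-1))\<close> expresses the weight in the \<open>qprod\<close>
    basis.\<close>
  have "poly P z = (- 1) ^ n * (qprod b (Suc r) z + (b ^ r - b ^ (n - 1)) * qprod b r z)" for z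
    by (simp add: P qprod_Suc algebra_simps)
  then have "(\<Sum>C\<in>X n. poly P (zeta n C)) = (- 1) ^ n * (S n (Suc r) + (b ^ r - b ^ (n - 1)) * S n r)"
    by (simp add: S_def sum.distrib sum_distrib_left distrib_left)
  also have "\<dots> = ?p * (b ^ (n * (n - r - 1)) * (b ^ r - b ^ n) + (b ^ r - b ^ (n - 1)) * b ^ (n * (n - r)))"
  proof -
    have "e * (- (e * u * (v * (x - t))) + y * (e * w * v)) = v * (u * (t - x) + y * w)"
      if "e * e = 1" for e t u v w x y :: real
    proof -
      have "e * (- (e * u * (v * (x - t))) + y * (e * w * v)) = (e * e) * (v * (u * (t - x) + y * w))"
        by (simp add: algebra_simps)
      then show ?thesis by (simp add: that)
    qed
    then show ?thesis unfolding Sr Sr' by this (simp flip: power_mult_distrib)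
  qed
  finally have "?p * (real (card Y) * (b ^ n - b ^ (n - 1)) * (- 1) ^ n)
      \<le> ?p * (b ^ (n * (n - r - 1)) * (b ^ r - b ^ n) + (b ^ r - b ^ (n - 1)) * b ^ (n * (n - r)))"
    using delsarte_bound[OF Y deg nonneg] by (simp add: P mult_ac)
  moreover have "?p > 0"
    using qprod_power_nonneg[OF r(1), of n] qprod_power_nonzero[of r n] r(2) by simp
  ultimately show ?thesis by simp
qed

end

section \<open>Rewriting the bound in terms of \<open>n\<close>, \<open>d\<close> and
  \<open>q\<close>\<close>

theorem theorem3p2:
  fixes Y :: "'a::{finite, field} mat set"
    and q n d :: nat
  assumes "\<exists>p k. prime p \<and> k > 0 \<and> q = p ^ k"
    and "card (UNIV :: 'a set) = q ^ 2"
    and "n \<ge> 2"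
    and "even d" and "2 \<le> d" and "d \<le> n"
    and "is_d_code n q d Y"
  shows "real (card Y) \<le>
    (-1) ^ (n + 1) * real q ^ (n * (n - d + 1)) *
    ((((- real q) ^ (n - d + 2) - 1) + (- real q) ^ n * ((- real q) ^ (n - d + 1) - 1))
      / ((- real q) ^ (n - d + 2) - (- real q) ^ (n - d + 1)))"
proof -
  obtain p k where pk: "prime p" "k > 0" "q = p ^ k" using assms(1) by blast
  have "prime CHAR('a)"
    using prime_CHAR_semidom finite_imp_CHAR_pos[where ?'a='a] by simp
  moreover have "CHAR('a) dvd p ^ (k * 2)"
    using CHAR_dvd_card_UNIV[where ?'a='a] assms(2) pk(3) by (simp add: power_mult)
  ultimately have "CHAR('a) = p" using pk(1) by (metis prime_dvd_power primes_dvd_imp_eq)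
  then have q: "\<exists>k. q = CHAR('a) ^ k" using pk(3) by blast
  obtain \<psi> :: "'a \<Rightarrow> complex" where
    "\<forall>x y. \<psi> (x + y) = \<psi> x * \<psi> y" "\<forall>x. norm (\<psi> x) = 1" "\<psi> 1 \<noteq> 1"
    using exists_additive_character by blast
  then interpret hermitian_forms q \<psi>
    using q assms(2) by unfold_locales auto
  obtain r where r: "d = Suc (Suc r)" using assms(5) by (metis add_2_eq_Suc le_Suc_ex)
  obtain m where m: "n = m + d" using assms(6) by (metis add.commute le_Suc_ex)
  have n: "n - r = m + 2" "n - r - 1 = m + 1" "n - 1 = m + 1 + r" "n = m + 2 + r" "n - d = m"
    using m r by auto
  \<comment> \<open>As \<open>d\<close> is even, \<open>n\<close> and \<open>m = n - d\<close> have
    the same parity, so \<open>n\<close> or \<open>m + 1\<close> is even; hence the prefactor may be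
    written with \<open>b\<close> in place of \<open>q\<close>.\<close>
  have "even (n * (m + 1))" using assms(4) m by auto
  then have bq: "real q ^ (n * (m + 1)) = b ^ (n * (m + 1))" by simp
  define \<epsilon> :: real where "\<epsilon> = (- 1) ^ n"
  have \<epsilon>: "\<epsilon> * \<epsilon> = 1" by (simp add: \<epsilon>_def flip: power_mult_distrib)
  define D where "D = b ^ (m + 2) - b ^ (m + 1)"
  have "b ^ n - b ^ (n - 1) = b ^ r * D"
    unfolding n(3) unfolding n(4) D_def by (simp add: power_add algebra_simps)
  moreover have "b ^ (n * (m + 1)) * (b ^ r - b ^ n) + (b ^ r - b ^ (n - 1)) * b ^ (n * (m + 2))
      = - (b ^ r * (b ^ (n * (m + 1)) * ((b ^ (m + 2) - 1) + b ^ n * (b ^ (m + 1) - 1))))"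
  proof -
    have "b ^ (n * (m + 2)) = b ^ (n * (m + 1)) * b ^ n" by (simp add: distrib_left add_ac flip: power_add)
    moreover have "b ^ n = b ^ (m + 2) * b ^ r" using n(4) by (metis power_add)
    moreover have "b ^ (n - 1) = b ^ (m + 1) * b ^ r" using n(3) by (metis power_add)
    moreover have "u * (v - x * v) + (v - y * v) * (u * (x * v))
        = - (v * (u * ((x - 1) + (x * v) * (y - 1))))" for u v x y :: real
      by (simp add: algebra_simps)
    ultimately show ?thesis by (simp only:)
  qed
  ultimately have "real (card Y) * (b ^ r * D) * \<epsilon>
      \<le> - (b ^ r * (b ^ (n * (m + 1)) * ((b ^ (m + 2) - 1) + b ^ n * (b ^ (m + 1) - 1))))"
    using code_bound[of n r Y] assms(4,6,7) r n unfolding \<epsilon>_def by simp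
  \<comment> \<open>Since \<open>r = d - 2\<close> is even, this common factor is positive and
    cancels without reversing the inequality.\<close>
  moreover have "b ^ r > 0" using assms(4) r q_gt_1 by simp
  ultimately have "b ^ r * (real (card Y) * D * \<epsilon>)
      \<le> b ^ r * - (b ^ (n * (m + 1)) * ((b ^ (m + 2) - 1) + b ^ n * (b ^ (m + 1) - 1)))"
    by (simp add: mult_ac)
  then have le: "real (card Y) * (D * \<epsilon>)
      \<le> - (b ^ (n * (m + 1)) * ((b ^ (m + 2) - 1) + b ^ n * (b ^ (m + 1) - 1)))"
    using \<open>b ^ r > 0\<close> by (simp only: mult_le_cancel_left_pos mult.assoc)
  \<comment> \<open>The denominator is \<open>D = b^m q (q + 1)\<close>, whose sign is that of
    \<open>b^m\<close>, namely \<open>\<epsilon>\<close>; so the division keeps the direction of the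
    inequality.\<close>
  have pos: "D * \<epsilon> > 0"
  proof -
    have "even d" by fact
    then have "\<epsilon> = (- 1) ^ m" by (simp add: \<epsilon>_def m power_add)
    then have "b ^ m = \<epsilon> * real q ^ m" by (simp add: power_minus[of "real q"])
    moreover have "D = b ^ m * (real q * (real q + 1))"
      by (simp add: D_def algebra_simps)
    ultimately have "D * \<epsilon> = \<epsilon> * \<epsilon> * (real q ^ m * (real q * (real q + 1)))"
      by (simp only: mult_ac)
    then show ?thesis using q_gt_1 \<epsilon> by simp
  qed
  have "real (card Y)
      \<le> - (b ^ (n * (m + 1)) * ((b ^ (m + 2) - 1) + b ^ n * (b ^ (m + 1) - 1))) / (D * \<epsilon>)"
    using le by (subst pos_le_divide_eq[OF pos])
  also have "\<dots> = - \<epsilon> * b ^ (n * (m + 1)) * (((b ^ (m + 2) - 1) + b ^ n * (b ^ (m + 1) - 1)) / D)"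
  proof -
    have "\<epsilon> = 1 \<or> \<epsilon> = - 1" by (simp add: \<epsilon>_def minus_one_power_iff)
    then show ?thesis by auto
  qed
  finally show ?thesis unfolding n(5) bq by (simp add: \<epsilon>_def D_def)
qed

end
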